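(* Let $K$ be any field and $R=K[x_0,\dots,x_n]$. Let $\underline{h}=(h_0,h_1,\dots,h_s)$ with $h_0=1$, $h_1\le n+1$, be a finite sequence of positive integers which is a unimodal O-sequence and whose positive part of the first difference $\bar h$ is an O-sequence. Let $I\subset R$ be an ideal obtained from $\underline h$ by the construction described in the context from homogeneous Artinian ideals $\bar J_1\subset\dots\subset\bar J_\ell\subset \bar R=K[x_1,\dots,x_n]$, with the further assumption that $\bar J_2,\dots,\bar J_\ell$ satisfy $$h_{\bar R/\bar J_i}(t)=\Delta h^{(i)}(t)\quad\text{for all } t \text{ and all } i=2,\dots,\ell,$$ where $$h^{(i)}(t):=\begin{cases}\min\{h_t,h_{u_i}\} & \text{if } t<u_i,\\ h_{u_i} & \text{otherwise.}\end{cases}$$ Then $A=R/I$ has the Strong Lefschetz property.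
   Context: A standard graded Artinian $K$-algebra $A$ has the Strong Lefschetz property if there is $\ell\in A_1$ such that $\times \ell^d: A_i\to A_{i+d}$ has maximal rank for all $i\ge0$, $d\ge1$. $h_A(t)=\dim_K A_t$; $\Delta h(t)=h(t)-h(t-1)$, with values at negative arguments being $0$. An O-sequence is a sequence that is the Hilbert function of some standard graded $K$-algebra. Put $h_{s+1}=0$, $h_{-1}=0$ and $\bar h(j):=\max\{h_j-h_{j-1},0\}$. Under the hypotheses there are integers $u_1<\dots<u_\ell$ with $$h_0<h_1<\cdots<h_{u_1}=\cdots=h_{u_2-1}>h_{u_2}=\cdots=h_{u_3-1}>h_{u_3}=\cdots>h_{u_\ell}=\cdots=h_s>0.$$ Construction: choose homogeneous Artinian ideals $\bar J_1\subset \bar J_2\subset\dots\subset\bar J_\ell\subset\bar R$ such that $\bar R/\bar J_1$ has Hilbert function $\bar h$ and $\dim_K\bar R/\bar J_i=h_{u_i}$ for $i=2,\dots,\ell$. Put $J_i=\bar J_iR$ and $$I:=J_1+\sum_{i=2}^{\ell}[J_i]_{\ge u_i}+\mathfrak m^{s+1},\qquad \mathfrak m=(x_0,\dots,x_n),$$ where $[J_i]_{\ge u_i}=\bigoplus_{t\ge u_i}[J_i]_t$. *)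

theory Defs
  imports
    "HOL-Algebra.QuotRing"
    "HOL-Algebra.Ideal_Product"
    "HOL-Algebra.Embedded_Algebras"
    "HOL-Library.Poly_Mapping"
    "HOL-Library.Set_Algebras"
begin

section \<open>Polynomial rings in finitely many variables\<close>

text \<open>Monomials are finitely supported exponent vectors. The ring \<open>K[x\<^sub>i | i \<in> V]\<close> is the subset of
  polynomials in which only variables with index in \<open>V\<close> occur, so that
  \<open>K[x\<^sub>1, \<dots>, x\<^sub>n]\<close> is literally contained in \<open>K[x\<^sub>0, \<dots>, x\<^sub>n]\<close>.\<close>

type_synonym 'k mpoly = "(nat \<Rightarrow>\<^sub>0 nat) \<Rightarrow>\<^sub>0 'k"

definition mpoly_ring :: "nat set \<Rightarrow> 'k::field mpoly ring"
  where "mpoly_ring V =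
    \<lparr> carrier = {p. \<forall>m\<in>Poly_Mapping.keys p. Poly_Mapping.keys m \<subseteq> V},
      monoid.mult = (*), one = 1, zero = 0, add = (+) \<rparr>"

definition const :: "'k::field \<Rightarrow> 'k mpoly"
  where "const c = Poly_Mapping.single 0 c"

definition var :: "nat \<Rightarrow> 'k::field mpoly"
  where "var i = Poly_Mapping.single (Poly_Mapping.single i 1) 1"

definition mdeg :: "(nat \<Rightarrow>\<^sub>0 nat) \<Rightarrow> nat"
  where "mdeg m = (\<Sum>i\<in>Poly_Mapping.keys m. Poly_Mapping.lookup m i)"

definition forms :: "nat set \<Rightarrow> nat \<Rightarrow> 'k::field mpoly set"
  where "forms V t = {p \<in> carrier (mpoly_ring V). \<forall>m\<in>Poly_Mapping.keys p. mdeg m = t}"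

definition hcomponent :: "nat \<Rightarrow> 'k::field mpoly \<Rightarrow> 'k mpoly"
  where "hcomponent t p =
    (\<Sum>m\<in>{m \<in> Poly_Mapping.keys p. mdeg m = t}. Poly_Mapping.single m (Poly_Mapping.lookup p m))"

definition homogeneous_ideal :: "nat set \<Rightarrow> 'k::field mpoly set \<Rightarrow> bool"
  where "homogeneous_ideal V I \<longleftrightarrow>
    ideal I (mpoly_ring V) \<and> (\<forall>p\<in>I. \<forall>t. hcomponent t p \<in> I)"


section \<open>Standard graded algebras and Hilbert functions\<close>

text \<open>A standard graded \<open>K\<close>-algebra is presented as a quotient \<open>R/I\<close> of a polynomial ring \<open>R\<close> in
  finitely many variables by a proper homogeneous ideal \<open>I\<close>.\<close>

definition standard_graded :: "nat set \<Rightarrow> 'k::field mpoly set \<Rightarrow> bool"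
  where "standard_graded V I \<longleftrightarrow>
    finite V \<and> homogeneous_ideal V I \<and> I \<noteq> carrier (mpoly_ring V)"

abbreviation quot_alg :: "nat set \<Rightarrow> 'k::field mpoly set \<Rightarrow> 'k mpoly set ring"
  where "quot_alg V I \<equiv> mpoly_ring V Quot I"

text \<open>The copy of \<open>K\<close> inside \<open>R/I\<close>; dimensions are taken over this subfield.\<close>

definition scalars :: "nat set \<Rightarrow> 'k::field mpoly set \<Rightarrow> 'k mpoly set set"
  where "scalars V I = range (\<lambda>c. I +>\<^bsub>mpoly_ring V\<^esub> const c)"

definition graded_part :: "nat set \<Rightarrow> 'k::field mpoly set \<Rightarrow> nat \<Rightarrow> 'k mpoly set set"
  where "graded_part V I t = (\<lambda>p. I +>\<^bsub>mpoly_ring V\<^esub> p) ` forms V t"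

definition hilbert :: "nat set \<Rightarrow> 'k::field mpoly set \<Rightarrow> nat \<Rightarrow> nat"
  where "hilbert V I t = ring.dim (quot_alg V I) (scalars V I) (graded_part V I t)"

definition O_sequence :: "'k::field itself \<Rightarrow> (nat \<Rightarrow> nat) \<Rightarrow> bool"
  where "O_sequence K h \<longleftrightarrow>
    (\<exists>r (I :: 'k mpoly set). standard_graded {..<r} I \<and> (\<forall>t. h t = hilbert {..<r} I t))"

definition artinian_ring :: "('a, 'b) ring_scheme \<Rightarrow> bool"
  where "artinian_ring A \<longleftrightarrow> ring A \<and>
    (\<forall>C :: nat \<Rightarrow> 'a set. (\<forall>i. ideal (C i) A \<and> C (Suc i) \<subseteq> C i) \<longrightarrow>
      (\<exists>N. \<forall>i\<ge>N. C i = C N))"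

text \<open>The map \<open>\<times>l^d: A\<^sub>i \<rightarrow> A\<^sub>i\<^sub>+\<^sub>d\<close> has maximal rank if its rank, i.e. the dimension of its image, is
  the minimum of the dimensions of its source and target.\<close>

definition strong_lefschetz :: "nat set \<Rightarrow> 'k::field mpoly set \<Rightarrow> bool"
  where "strong_lefschetz V I \<longleftrightarrow>
    standard_graded V I \<and> artinian_ring (quot_alg V I) \<and>
    (\<exists>l \<in> graded_part V I 1. \<forall>i d. d \<ge> 1 \<longrightarrow>
      ring.dim (quot_alg V I) (scalars V I)
        ((\<lambda>a. (l [^]\<^bsub>quot_alg V I\<^esub> d) \<otimes>\<^bsub>quot_alg V I\<^esub> a) ` graded_part V I i)
      = min (hilbert V I i) (hilbert V I (i + d)))"


section \<open>The sequence \<open>h\<close>\<close>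

text \<open>The finite sequence \<open>(h\<^sub>0, \<dots>, h\<^sub>s)\<close> is represented by a function on \<open>nat\<close> vanishing beyond \<open>s\<close>.\<close>

definition fst_diff :: "(nat \<Rightarrow> nat) \<Rightarrow> nat \<Rightarrow> int"
  where "fst_diff h t = int (h t) - (if t = 0 then 0 else int (h (t - 1)))"

definition pos_diff :: "(nat \<Rightarrow> nat) \<Rightarrow> nat \<Rightarrow> nat"
  where "pos_diff h t = nat (max (fst_diff h t) 0)"

definition unimodal :: "(nat \<Rightarrow> nat) \<Rightarrow> nat \<Rightarrow> bool"
  where "unimodal h s \<longleftrightarrow> (\<exists>k\<le>s. mono_on {..k} h \<and> antimono_on {k..s} h)"

text \<open>\<open>h\<^sub>0 < \<dots> < h\<^bsub>u 1\<^esub> = \<dots> = h\<^bsub>u 2 - 1\<^esub> > h\<^bsub>u 2\<^esub> = \<dots> > h\<^bsub>u L\<^esub> = \<dots> = h\<^sub>s\<close>; these conditions determine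
  \<open>L\<close> and \<open>u 1 < \<dots> < u L\<close> uniquely.\<close>

definition plateaus :: "(nat \<Rightarrow> nat) \<Rightarrow> nat \<Rightarrow> nat \<Rightarrow> (nat \<Rightarrow> nat) \<Rightarrow> bool"
  where "plateaus h s L u \<longleftrightarrow>
    1 \<le> L \<and> strict_mono_on {1..L} u \<and> u L \<le> s \<and>
    strict_mono_on {..u 1} h \<and>
    (\<forall>i\<in>{1..<L}. \<forall>t\<in>{u i..<u (i + 1)}. h t = h (u i)) \<and>
    (\<forall>t\<in>{u L..s}. h t = h (u L)) \<and>
    (\<forall>i\<in>{2..L}. h (u i - 1) > h (u i))"

definition trunc_seq :: "(nat \<Rightarrow> nat) \<Rightarrow> nat \<Rightarrow> nat \<Rightarrow> nat"
  where "trunc_seq h v t = (if t < v then min (h t) (h v) else h v)"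


section \<open>The construction\<close>

definition irrelevant_ideal :: "nat set \<Rightarrow> 'k::field mpoly set"
  where "irrelevant_ideal V = Idl\<^bsub>mpoly_ring V\<^esub> (var ` V)"

text \<open>\<open>[J]\<^bsub>\<ge>v\<^esub>\<close>, the internal direct sum of the components \<open>[J]\<^sub>t\<close> with \<open>t \<ge> v\<close>.\<close>

definition trunc_ideal :: "nat set \<Rightarrow> 'k::field mpoly set \<Rightarrow> nat \<Rightarrow> 'k mpoly set"
  where "trunc_ideal V J v =
    {\<Sum>t\<in>T. g t | g T. finite T \<and> T \<subseteq> {v..} \<and> (\<forall>t\<in>T. g t \<in> J \<inter> forms V t)}"

text \<open>Here \<open>+\<close> and \<open>\<Sum>\<close> are the elementwise operations on sets from \<open>Set_Algebras\<close>, whereas the power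
  is the one in the monoid of ideals. The \<open>J i\<close> are ideals of \<open>K[x\<^sub>1, \<dots>, x\<^sub>n]\<close>.\<close>

definition lefschetz_ideal ::
    "nat \<Rightarrow> nat \<Rightarrow> nat \<Rightarrow> (nat \<Rightarrow> nat) \<Rightarrow> (nat \<Rightarrow> 'k::field mpoly set) \<Rightarrow> 'k mpoly set"
  where "lefschetz_ideal n s L u J =
    (let R = mpoly_ring {0..n} in
      (Idl\<^bsub>R\<^esub> (J 1)) + (\<Sum>i\<in>{2..L}. trunc_ideal {0..n} (Idl\<^bsub>R\<^esub> (J i)) (u i))
        + irrelevant_ideal {0..n} [^]\<^bsub>ideals_set R\<^esub> (s + 1))"

end

theory Submission
  imports Defs
begin

text \<open>The Lefschetz element is \<open>x\<^sub>0\<close>. In degree \<open>t \<le> s\<close> the ideal \<open>I\<close> agrees with \<open>J\<^sub>b\<close>, where \<open>b\<close> is the index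
  of the plateau containing \<open>t\<close> (and \<open>b = 1\<close> for \<open>t < u\<^sub>2\<close>), and \<open>x\<^sub>0\<close> is a nonzerodivisor modulo \<open>J\<^sub>b\<close>
  because \<open>R/J\<^sub>b\<close> is a polynomial ring in \<open>x\<^sub>0\<close> over the quotient of \<open>K[x\<^sub>1, \<dots>, x\<^sub>n]\<close> by the
  \<open>b\<close>-th given ideal. Hence the image of \<open>A\<^sub>i\<close> under \<open>x\<^sub>0^d\<close> is isomorphic to \<open>R\<^sub>i\<close> modulo
  the forms in \<open>J\<^sub>b\<close>, with \<open>b\<close> belonging to \<open>t = i + d\<close>. Its dimension is the partial sum up to \<open>i\<close> of the
  given first differences, i.e. \<open>h\<^sub>i\<close> if \<open>b = 1\<close> and the truncated sequence \<open>h\<^sup>(\<^sup>b\<^sup>)(i)\<close> otherwise, and in both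
  cases this is the minimum of \<open>h\<^sub>i\<close> and \<open>h\<^bsub>i + d\<^esub>\<close>.\<close>

section \<open>Finite-dimensional subspaces\<close>

text \<open>Hilbert functions and ranks are stated as dimensions of sets of cosets over a subfield
  of cosets. They are all turned into differences \<open>dim U - dim (U \<inter> I)\<close> of
  spaces of polynomials. The ambient space has infinite dimension, which is why finite spanning sets
  are carried along everywhere. The partial sums arise because adjoining \<open>x\<^sub>0\<close>
  makes the quotient a direct sum of copies of the smaller one, shifted by the powers of
  \<open>x\<^sub>0\<close>. The minimum arises as follows, with \<open>b\<close> fixed by the target
  degree. For \<open>b = 1\<close> no drop has occurred up to \<open>i + d\<close>, so the source
  value is the smaller one. For \<open>b \<ge> 2\<close> the target value is \<open>h (u b)\<close>;
  below \<open>u b\<close> the truncated sequence is the minimum with this value by definition, and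
  from \<open>u b\<close> up to \<open>i + d\<close> source and target lie on one plateau. If
  \<open>i + d > s\<close>, the target is zero and the unit ideal takes the place of the given
  ideal, so that the same rank computation applies.\<close>

context vector_space
begin

text \<open>\<open>dim\<close> is 0 on infinite-dimensional spaces, hence the finite spanning set
  \<open>F\<close>. Adapted bases of a nested pair serve both for comparing dimensions and for the
  dimension of a quotient.\<close>

lemma finite_basis_extension:
  assumes "subspace U" "subspace V" "U \<subseteq> V" "V \<subseteq> span F" "finite F"
  obtains B C where "B \<subseteq> C" "finite C" "independent B" "independent C" "span B = U" "span C = V"
    "card B = dim U" "card C = dim V"
proof -
  obtain B where B: "B \<subseteq> U" "independent B" "U \<subseteq> span B" "card B = dim U"
    using basis_exists by blast
  obtain C where C: "B \<subseteq> C" "C \<subseteq> V" "independent C" "V \<subseteq> span C"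
    using maximal_independent_subset_extend[of B V] B assms(3) by blast
  show ?thesis
  proof
    show "B \<subseteq> C" "independent B" "independent C" "card B = dim U"
      by fact+
    show "finite C"
      using independent_span_bound[OF assms(5) C(3)] C(2) assms(4) by auto
    show "span B = U"
      using B(1,3) span_minimal[OF B(1) assms(1)] by (rule_tac subset_antisym)
    show "span C = V"
      using C(2,4) span_minimal[OF C(2) assms(2)] by (rule_tac subset_antisym)
    show "card C = dim V"
      using C basis_card_eq_dim by blast
  qed
qed

lemma finite_basis:
  assumes "subspace U" "U \<subseteq> span F" "finite F"
  obtains B where "finite B" "independent B" "span B = U" "card B = dim U"
  by (rule finite_basis_extension[OF assms(1,1) subset_refl assms(2,3)])

lemma dim_mono_fin:
  assumes "subspace U" "subspace V" "U \<subseteq> V" "V \<subseteq> span F" "finite F"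
  shows "dim U \<le> dim V"
  by (rule finite_basis_extension[OF assms]) (metis card_mono)

lemma subspace_eq_if_dim_eq:
  assumes "subspace U" "subspace V" "U \<subseteq> V" "V \<subseteq> span F" "finite F" "dim U = dim V"
  shows "U = V"
  by (rule finite_basis_extension[OF assms(1-5)]) (metis card_subset_eq assms(6))

lemma dim_direct_sum:
  assumes "subspace U" "subspace V" "U \<inter> V \<subseteq> {0}"
    and "U \<subseteq> span F" "finite F" "V \<subseteq> span G" "finite G"
  shows "dim {x + y |x y. x \<in> U \<and> y \<in> V} = dim U + dim V"
proof -
  obtain B where B: "finite B" "independent B" "span B = U" "card B = dim U"
    by (rule finite_basis[OF assms(1,4,5)])
  obtain C where C: "finite C" "independent C" "span C = V" "card C = dim V"
    by (rule finite_basis[OF assms(2,6,7)])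
  have "B \<inter> C \<subseteq> U \<inter> V"
    using B(3) C(3) span_superset by blast
  then have disj: "B \<inter> C = {}"
    using assms(3) B(2) dependent_zero by blast
  \<comment> \<open>The basis \<open>B\<close> is kept and elements of \<open>C\<close> are added
    one at a time: a relation \<open>c = d + b\<close> would put \<open>b = c - d\<close> into
    \<open>U \<inter> V\<close>, so it would already be a relation inside \<open>C\<close>.\<close>
  have "independent (D \<union> B)" if "finite D" "D \<subseteq> C" for D
    using that
  proof (induction D)
    case empty
    then show ?case using B by simp
  next
    case (insert c D)
    have CD: "insert c D \<subseteq> C"
      using insert.prems by simp
    have "c \<notin> span (D \<union> B)"
    proof
      assume "c \<in> span (D \<union> B)"
      then obtain d b where d: "d \<in> span D" and b: "b \<in> span B" and c: "c = d + b"
        unfolding span_Un by blast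
      have "c \<in> span C" "d \<in> span C"
        using CD d span_base[of c C] span_mono[of D C] by auto
      then have "c - d \<in> V"
        using C(3) span_diff by blast
      then have "b \<in> U \<inter> V"
        using B(3) b c by simp
      then have "c = d"
        using assms(3) c by auto
      moreover have "c \<notin> span D"
        using independent_mono[OF C(2) CD] insert.hyps independent_insert[of c D] by simp
      ultimately show False
        using d by simp
    qed
    then have "independent (insert c (D \<union> B))"
      using insert.IH CD by (intro independent_insertI) simp_all
    then show ?case
      by simp
  qed
  then have "independent (C \<union> B)"
    using C(1) by blast
  then have "dim (span (C \<union> B)) = card (C \<union> B)"
    by (rule dim_span_eq_card_independent)
  moreover have "span (C \<union> B) = {x + y |x y. x \<in> U \<and> y \<in> V}"
    using B(3) C(3) by (subst Un_commute, subst span_Un) auto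
  ultimately show ?thesis
    using B(1,4) C(1,4) disj card_Un_disjoint[of C B] by (simp add: Int_commute)
qed

lemma dim_inj_image:
  assumes "Vector_Spaces.linear scale scale f" "subspace U" "inj_on f U" "U \<subseteq> span F" "finite F"
  shows "dim (f ` U) = dim U"
proof -
  interpret f: Vector_Spaces.linear scale scale f by fact
  interpret P: vector_space_pair scale scale ..
  obtain B where B: "finite B" "independent B" "span B = U" "card B = dim U"
    by (rule finite_basis[OF assms(2,4,5)])
  have "independent (f ` B)"
    using P.linear_independent_injective_image[OF assms(1) B(2)] assms(3) B(3) by simp
  moreover have "span (f ` B) = f ` U"
    using P.linear_span_image[OF assms(1)] B(3) by metis
  moreover have "card (f ` B) = card B"
    using card_image[OF inj_on_subset[OF assms(3)]] B(3) span_superset[of B] by simp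
  ultimately show ?thesis
    using B(4) dim_eq_card_independent[of "f ` B"] dim_span[of "f ` B"] by simp
qed

end

section \<open>Polynomial rings and their ideals\<close>

lemma mpoly_ring_simps [simp]:
  "mult (mpoly_ring V) = (*)" "one (mpoly_ring V) = 1" "zero (mpoly_ring V) = 0" "add (mpoly_ring V) = (+)"
  by (simp_all add: mpoly_ring_def)

lemma mem_carrier_mpoly_ring:
  "p \<in> carrier (mpoly_ring V) \<longleftrightarrow> (\<forall>m. Poly_Mapping.lookup p m \<noteq> 0 \<longrightarrow> Poly_Mapping.keys m \<subseteq> V)"
  by (auto simp: mpoly_ring_def in_keys_iff)

lemma keys_add_nat:
  "Poly_Mapping.keys (a + b :: 'a \<Rightarrow>\<^sub>0 nat) = Poly_Mapping.keys a \<union> Poly_Mapping.keys b"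
  by (auto simp: in_keys_iff lookup_add)

lemma carrier_mpoly_ring_zero [simp]: "0 \<in> carrier (mpoly_ring V)"
  by (simp add: mpoly_ring_def)

lemma carrier_mpoly_ring_add:
  "p \<in> carrier (mpoly_ring V) \<Longrightarrow> q \<in> carrier (mpoly_ring V) \<Longrightarrow> p + q \<in> carrier (mpoly_ring V)"
  using Poly_Mapping.keys_add[of p q] by (auto simp: mpoly_ring_def)

lemma carrier_mpoly_ring_sum:
  "(\<And>i. i \<in> T \<Longrightarrow> f i \<in> carrier (mpoly_ring V)) \<Longrightarrow> sum f T \<in> carrier (mpoly_ring V)"
  by (induction T rule: infinite_finite_induct) (auto intro: carrier_mpoly_ring_add)

lemma carrier_mpoly_ring_uminus:
  "p \<in> carrier (mpoly_ring V) \<Longrightarrow> - p \<in> carrier (mpoly_ring V)"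
  by (auto simp: mem_carrier_mpoly_ring)

lemma carrier_mpoly_ring_mult:
  assumes "p \<in> carrier (mpoly_ring V)" "q \<in> carrier (mpoly_ring V)"
  shows "p * q \<in> carrier (mpoly_ring V)"
proof -
  have "Poly_Mapping.keys m \<subseteq> V" if "m \<in> Poly_Mapping.keys (p * q)" for m
  proof -
    obtain a b where "m = a + b" "a \<in> Poly_Mapping.keys p" "b \<in> Poly_Mapping.keys q"
      using keys_mult[of p q] \<open>m \<in> _\<close> by blast
    then show ?thesis
      using assms keys_add_nat[of a b] by (auto simp: mpoly_ring_def)
  qed
  then show ?thesis
    by (simp add: mpoly_ring_def)
qed

lemma carrier_mpoly_ring_single [simp]:
  "Poly_Mapping.single m c \<in> carrier (mpoly_ring V) \<longleftrightarrow> c = 0 \<or> Poly_Mapping.keys m \<subseteq> V"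
  by (simp add: mpoly_ring_def)

lemma carrier_mpoly_ring_const [simp]: "const c \<in> carrier (mpoly_ring V)"
  by (simp add: const_def)

lemma carrier_mpoly_ring_one [simp]: "1 \<in> carrier (mpoly_ring V)"
  by (simp add: mpoly_ring_def)

lemma carrier_mpoly_ring_var: "i \<in> V \<Longrightarrow> var i \<in> carrier (mpoly_ring V)"
  by (simp add: var_def)

lemma carrier_mpoly_ring_mono: "V \<subseteq> W \<Longrightarrow> carrier (mpoly_ring V) \<subseteq> carrier (mpoly_ring W)"
  by (auto simp: mpoly_ring_def)

lemma cring_mpoly_ring: "cring (mpoly_ring V)"
proof (rule cringI)
  show "abelian_group (mpoly_ring V)"
    by (rule abelian_groupI)
      (auto simp: carrier_mpoly_ring_add add_ac intro: carrier_mpoly_ring_uminus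
        intro!: bexI[where x = "- _"])
  show "Group.comm_monoid (mpoly_ring V)"
    by (rule comm_monoidI) (auto simp: carrier_mpoly_ring_mult mult_ac)
qed (auto simp: distrib_right)

lemma ring_mpoly_ring: "ring (mpoly_ring V)"
  using cring_mpoly_ring by (rule cring.axioms(1))

lemma a_inv_mpoly_ring [simp]:
  "p \<in> carrier (mpoly_ring V) \<Longrightarrow> \<ominus>\<^bsub>mpoly_ring V\<^esub> p = - p"
  by (metis add.right_inverse carrier_mpoly_ring_uminus mpoly_ring_simps(3,4)
      ring_mpoly_ring abelian_group.minus_equality add.commute ring.is_abelian_group)

text \<open>Closure under negation does not appear on the right because it follows from absorbing
  the constant -1.\<close>

lemma ideal_mpoly_ring_iff:
  "ideal I (mpoly_ring V) \<longleftrightarrow> I \<subseteq> carrier (mpoly_ring V) \<and> 0 \<in> I \<and>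
    (\<forall>p\<in>I. \<forall>q\<in>I. p + q \<in> I) \<and> (\<forall>r\<in>carrier (mpoly_ring V). \<forall>p\<in>I. r * p \<in> I)"
  (is "_ \<longleftrightarrow> ?rhs")
proof
  assume "ideal I (mpoly_ring V)"
  then interpret I: ideal I "mpoly_ring V" .
  show ?rhs
    using I.a_subset I.I_l_closed additive_subgroup.zero_closed[OF I.additive_subgroup_axioms]
      additive_subgroup.a_closed[OF I.additive_subgroup_axioms] by simp
next
  assume I: ?rhs
  have "- p \<in> I" if "p \<in> I" for p
    using I that carrier_mpoly_ring_uminus[OF carrier_mpoly_ring_one, of V] by (metis mult_minus1)
  then have "subgroup I (add_monoid (mpoly_ring V))"
  proof (intro subgroup.intro)
    show "inv\<^bsub>add_monoid (mpoly_ring V)\<^esub> p \<in> I" if "p \<in> I" for p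
      using that I a_inv_mpoly_ring[of p V] \<open>\<And>p. p \<in> I \<Longrightarrow> - p \<in> I\<close> by (auto simp only: a_inv_def)
  qed (use I in auto)
  moreover have "p * r \<in> I" if "p \<in> I" "r \<in> carrier (mpoly_ring V)" for p r
    using I that by (metis mult.commute)
  ultimately show "ideal I (mpoly_ring V)"
    using I by (intro idealI[OF ring_mpoly_ring]) auto
qed

lemma ideal_uminus_mpoly: "ideal I (mpoly_ring V) \<Longrightarrow> p \<in> I \<Longrightarrow> - p \<in> I"
  using ideal_mpoly_ring_iff[of I V] carrier_mpoly_ring_uminus[OF carrier_mpoly_ring_one, of V]
  by (metis mult_minus1)

lemma ideal_diff_mpoly: "ideal I (mpoly_ring V) \<Longrightarrow> p \<in> I \<Longrightarrow> q \<in> I \<Longrightarrow> p - q \<in> I"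
  using ideal_uminus_mpoly[of I V q] ideal_mpoly_ring_iff[of I V] by (metis add_uminus_conv_diff)

lemma ideal_sum_mpoly:
  "ideal I (mpoly_ring V) \<Longrightarrow> (\<And>i. i \<in> T \<Longrightarrow> f i \<in> I) \<Longrightarrow> sum f T \<in> I"
  by (induction T rule: infinite_finite_induct) (auto simp: ideal_mpoly_ring_iff)

lemma const_simps:
  "const (a + b) = const a + const b" "const (a * b) = const a * const b"
  "const 0 = 0" "const 1 = 1" "const (- a) = - const a"
  by (simp_all add: const_def single_add mult_single single_uminus)

text \<open>Scalars act as constant polynomials, so ideals are subspaces and the dimension theory of
  \<open>vector_space\<close> applies to sets of polynomials.\<close>

global_interpretation mpoly: vector_space "\<lambda>c p. const c * p :: 'k::field mpoly"
  by unfold_locales (simp_all add: const_simps algebra_simps)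

lemma subspace_ideal: "ideal I (mpoly_ring V) \<Longrightarrow> mpoly.subspace I"
  by (simp add: mpoly.subspace_def ideal_mpoly_ring_iff)

lemma subspace_carrier: "mpoly.subspace (carrier (mpoly_ring V))"
  by (simp add: mpoly.subspace_def carrier_mpoly_ring_add carrier_mpoly_ring_mult)

subsection \<open>Coefficients and degrees\<close>

lemma sum_singles:
  "p = (\<Sum>m\<in>Poly_Mapping.keys p. Poly_Mapping.single m (Poly_Mapping.lookup p m))"
  by (rule poly_mapping_eqI)
    (simp add: lookup_sum lookup_single when_def in_keys_iff)

text \<open>Subtraction of exponent vectors is truncated, so divisibility has to be tested:
  \<open>a + k = m\<close> has the only solution \<open>k = m - a\<close> if \<open>a\<close>
  divides \<open>m\<close>, and none otherwise.\<close>

lemma lookup_single_times: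
  fixes p :: "('a \<Rightarrow>\<^sub>0 nat) \<Rightarrow>\<^sub>0 'k::semiring_0"
  shows "Poly_Mapping.lookup (Poly_Mapping.single a c * p) m =
    (if \<forall>i. Poly_Mapping.lookup a i \<le> Poly_Mapping.lookup m i then c * Poly_Mapping.lookup p (m - a) else 0)"
proof -
  have eq: "a + k = m \<longleftrightarrow> (\<forall>i. Poly_Mapping.lookup a i \<le> Poly_Mapping.lookup m i) \<and> k = m - a"
    for k
    by (auto simp: poly_mapping_eq_iff fun_eq_iff lookup_add lookup_minus)
      (metis le_add1, metis add_diff_cancel_left')
  have "Poly_Mapping.single a c * p =
      (\<Sum>k\<in>Poly_Mapping.keys p. Poly_Mapping.single (a + k) (c * Poly_Mapping.lookup p k))"
    by (subst (1) sum_singles[of p]) (simp add: sum_distrib_left mult_single)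
  then have "Poly_Mapping.lookup (Poly_Mapping.single a c * p) m =
      (\<Sum>k\<in>Poly_Mapping.keys p. c * Poly_Mapping.lookup p k when a + k = m)"
    by (simp add: lookup_sum lookup_single)
  also have "\<dots> = (if \<forall>i. Poly_Mapping.lookup a i \<le> Poly_Mapping.lookup m i
      then c * Poly_Mapping.lookup p (m - a) else 0)"
  proof (cases "\<forall>i. Poly_Mapping.lookup a i \<le> Poly_Mapping.lookup m i")
    case True
    then show ?thesis
      by (simp add: eq when_def in_keys_iff)
  next
    case False
    then show ?thesis
      by (simp only: eq False simp_thms if_False when_simps sum.neutral_const)
  qed
  finally show ?thesis .
qed

lemma lookup_const_times: "Poly_Mapping.lookup (const c * p) m = c * Poly_Mapping.lookup p m"
  by (simp add: const_def lookup_single_times)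

lemma lookup_hcomponent:
  "Poly_Mapping.lookup (hcomponent t p) m = (if mdeg m = t then Poly_Mapping.lookup p m else 0)"
  by (auto simp: hcomponent_def lookup_sum lookup_single when_def in_keys_iff)

lemma mdeg_superset:
  "finite S \<Longrightarrow> Poly_Mapping.keys m \<subseteq> S \<Longrightarrow> mdeg m = (\<Sum>i\<in>S. Poly_Mapping.lookup m i)"
  unfolding mdeg_def by (rule sum.mono_neutral_left) (auto simp: in_keys_iff)

lemma mdeg_add: "mdeg (a + b) = mdeg a + mdeg b"
  using mdeg_superset[of "Poly_Mapping.keys a \<union> Poly_Mapping.keys b"]
  by (simp add: keys_add_nat lookup_add sum.distrib)

lemma mdeg_single [simp]: "mdeg (Poly_Mapping.single i j) = j"
  by (simp add: mdeg_def)

lemma mdeg_zero [simp]: "mdeg 0 = 0"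
  by (simp add: mdeg_def)

lemma lookup_le_mdeg: "Poly_Mapping.lookup m i \<le> mdeg m"
proof (cases "i \<in> Poly_Mapping.keys m")
  case True
  then show ?thesis
    unfolding mdeg_def by (intro member_le_sum) auto
qed (simp add: in_keys_iff)

lemma mem_forms: "p \<in> forms V t \<longleftrightarrow>
    (\<forall>m. Poly_Mapping.lookup p m \<noteq> 0 \<longrightarrow> Poly_Mapping.keys m \<subseteq> V \<and> mdeg m = t)"
  by (auto simp: forms_def mem_carrier_mpoly_ring in_keys_iff)

lemma forms_subset_carrier: "forms V t \<subseteq> carrier (mpoly_ring V)"
  by (auto simp: forms_def)

lemma subspace_forms: "mpoly.subspace (forms V t :: 'k::field mpoly set)"
proof -
  have "p + q \<in> forms V t" if pq: "p \<in> forms V t" "q \<in> forms V t" for p q :: "'k mpoly"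
  proof -
    have "mdeg m = t" if "m \<in> Poly_Mapping.keys (p + q)" for m
      using subsetD[OF Poly_Mapping.keys_add that] pq unfolding forms_def by blast
    then show ?thesis
      using pq by (simp add: forms_def carrier_mpoly_ring_add)
  qed
  moreover have "0 \<in> forms V t" "p \<in> forms V t \<Longrightarrow> const c * p \<in> forms V t"
    for c and p :: "'k mpoly"
    by (simp_all add: mem_forms lookup_const_times)
  ultimately show ?thesis
    unfolding mpoly.subspace_def by blast
qed

lemma hcomponent_forms: "p \<in> carrier (mpoly_ring V) \<Longrightarrow> hcomponent t p \<in> forms V t"
  by (simp add: mem_forms mem_carrier_mpoly_ring lookup_hcomponent)

lemma hcomponent_of_form: "p \<in> forms V t \<Longrightarrow> hcomponent t' p = (if t' = t then p else 0)"
  by (rule poly_mapping_eqI) (auto simp: mem_forms lookup_hcomponent)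

lemma hcomponent_add: "hcomponent t (p + q) = hcomponent t p + hcomponent t q"
  by (rule poly_mapping_eqI) (simp add: lookup_hcomponent lookup_add)

lemma hcomponent_zero [simp]: "hcomponent t 0 = 0"
  by (rule poly_mapping_eqI) (simp add: lookup_hcomponent)

lemma hcomponent_sum: "hcomponent t (sum f T) = (\<Sum>i\<in>T. hcomponent t (f i))"
  by (induction T rule: infinite_finite_induct) (auto simp: hcomponent_add)

lemma sum_hcomponents: "p = (\<Sum>t\<in>mdeg ` Poly_Mapping.keys p. hcomponent t p)"
proof (rule poly_mapping_eqI)
  fix m
  show "Poly_Mapping.lookup p m = Poly_Mapping.lookup (\<Sum>t\<in>mdeg ` Poly_Mapping.keys p. hcomponent t p) m"
    by (cases "m \<in> Poly_Mapping.keys p") (simp_all add: lookup_sum lookup_hcomponent in_keys_iff)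
qed

text \<open>Both claims are linear in \<open>r\<close>, which reduces them to monomials of degree
  \<open>d\<close>, where coefficients can be compared directly.\<close>

lemma hcomponent_form_times:
  assumes "r \<in> forms V d"
  shows "hcomponent (d + t) (r * p) = r * hcomponent t p"
    and "t < d \<Longrightarrow> hcomponent t (r * p) = 0"
proof -
  let ?s = "\<lambda>m. Poly_Mapping.single m (Poly_Mapping.lookup r m)"
  have r: "r = (\<Sum>m\<in>Poly_Mapping.keys r. ?s m)"
    by (rule sum_singles)
  have deg: "mdeg m = d" if "m \<in> Poly_Mapping.keys r" for m
    using assms that by (simp add: mem_forms in_keys_iff)
  have diff: "mdeg m = mdeg (m - a) + mdeg a" if "\<forall>i. Poly_Mapping.lookup a i \<le> Poly_Mapping.lookup m i"
    for m a :: "nat \<Rightarrow>\<^sub>0 nat"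
  proof -
    have "m = (m - a) + a"
      using that by (simp add: poly_mapping_eq_iff fun_eq_iff lookup_add lookup_minus)
    then show ?thesis
      using mdeg_add by metis
  qed
  have 1: "hcomponent (d + t) (?s m * p) = ?s m * hcomponent t p" if "m \<in> Poly_Mapping.keys r" for m t
    using diff[of m] deg[OF that]
    by (intro poly_mapping_eqI) (auto simp: lookup_hcomponent lookup_single_times)
  have 2: "hcomponent t (?s m * p) = 0" if "m \<in> Poly_Mapping.keys r" "t < d" for m t
    using diff[of m] deg[OF that(1)] that(2)
    by (intro poly_mapping_eqI) (auto simp: lookup_hcomponent lookup_single_times)
  have "hcomponent (d + t) (r * p) = (\<Sum>m\<in>Poly_Mapping.keys r. hcomponent (d + t) (?s m * p))"
    by (subst r) (simp add: sum_distrib_right hcomponent_sum)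
  also have "\<dots> = r * hcomponent t p"
    by (subst (3) r) (simp add: 1 sum_distrib_right)
  finally show "hcomponent (d + t) (r * p) = r * hcomponent t p" .
  have "hcomponent t (r * p) = (\<Sum>m\<in>Poly_Mapping.keys r. hcomponent t (?s m * p))"
    by (subst r) (simp add: sum_distrib_right hcomponent_sum)
  then show "t < d \<Longrightarrow> hcomponent t (r * p) = 0"
    by (simp add: 2)
qed

lemma forms_times:
  assumes "p \<in> forms V i" "q \<in> forms V j"
  shows "p * q \<in> forms V (i + j)"
proof -
  have "p * q \<in> carrier (mpoly_ring V)"
    using assms forms_subset_carrier carrier_mpoly_ring_mult by blast
  then show ?thesis
    using hcomponent_form_times(1)[OF assms(1), of j q] hcomponent_of_form[OF assms(2), of j]
      hcomponent_forms[of "p * q" V "i + j"] by simp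
qed

lemma var_form: "i \<in> V \<Longrightarrow> var i \<in> forms V 1"
  by (simp add: forms_def var_def)

lemma one_form: "1 \<in> forms V 0"
  by (simp add: forms_def)

lemma var_power_form: "i \<in> V \<Longrightarrow> var i ^ d \<in> forms V d"
proof (induction d)
  case (Suc d)
  then show ?case
    using forms_times[OF var_form, of i V "var i ^ d" d] by simp
qed (simp add: one_form)

text \<open>Exponents are bounded by the total degree, so restricting exponent vectors to
  \<open>V\<close> embeds these monomials into a finite function space.\<close>

lemma finite_monomials:
  assumes "finite V"
  shows "finite {m :: nat \<Rightarrow>\<^sub>0 nat. Poly_Mapping.keys m \<subseteq> V \<and> mdeg m \<le> t}"
proof (rule inj_on_finite)
  let ?f = "\<lambda>m. restrict (Poly_Mapping.lookup m) V"
  show "inj_on ?f {m. Poly_Mapping.keys m \<subseteq> V \<and> mdeg m \<le> t}"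
  proof (rule inj_onI, rule poly_mapping_eqI)
    fix a b k
    assume *: "a \<in> {m. Poly_Mapping.keys m \<subseteq> V \<and> mdeg m \<le> t}"
      "b \<in> {m. Poly_Mapping.keys m \<subseteq> V \<and> mdeg m \<le> t}" "?f a = ?f b"
    show "Poly_Mapping.lookup a k = Poly_Mapping.lookup b k"
    proof (cases "k \<in> V")
      case True
      then show ?thesis
        using fun_cong[OF *(3), of k] by simp
    next
      case False
      then have "k \<notin> Poly_Mapping.keys a" "k \<notin> Poly_Mapping.keys b"
        using * by auto
      then show ?thesis
        by (simp add: in_keys_iff)
    qed
  qed
  show "?f ` {m. Poly_Mapping.keys m \<subseteq> V \<and> mdeg m \<le> t} \<subseteq> V \<rightarrow>\<^sub>E {..t}"
    by (auto intro: order_trans[OF lookup_le_mdeg])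
  show "finite (V \<rightarrow>\<^sub>E {..t})"
    using assms by (simp add: finite_PiE)
qed

text \<open>All degrees up to \<open>t\<close> are included: the same set then spans the forms of
  degree \<open>t\<close> and the truncations of arbitrary polynomials that occur in the Artinian
  property.\<close>

definition monomials_upto :: "nat set \<Rightarrow> nat \<Rightarrow> 'k::field mpoly set"
  where "monomials_upto V t =
    (\<lambda>m. Poly_Mapping.single m 1) ` {m. Poly_Mapping.keys m \<subseteq> V \<and> mdeg m \<le> t}"

lemma finite_monomials_upto: "finite V \<Longrightarrow> finite (monomials_upto V t)"
  by (simp add: monomials_upto_def finite_monomials)

lemma span_monomials_upto:
  assumes "\<And>m. Poly_Mapping.lookup p m \<noteq> 0 \<Longrightarrow> Poly_Mapping.keys m \<subseteq> V \<and> mdeg m \<le> t"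
  shows "p \<in> mpoly.span (monomials_upto V t)"
proof -
  have "(\<Sum>m\<in>Poly_Mapping.keys p. const (Poly_Mapping.lookup p m) * Poly_Mapping.single m 1)
      \<in> mpoly.span (monomials_upto V t)"
    using assms
    by (intro mpoly.span_sum mpoly.span_scale mpoly.span_base)
      (auto simp: monomials_upto_def in_keys_iff)
  also have "(\<Sum>m\<in>Poly_Mapping.keys p. const (Poly_Mapping.lookup p m) * Poly_Mapping.single m 1) = p"
    by (subst (3) sum_singles[of p]) (simp add: const_def mult_single)
  finally show ?thesis .
qed

lemma forms_finite_dim: "forms V t \<subseteq> mpoly.span (monomials_upto V t)"
  by (intro subsetI span_monomials_upto) (simp add: mem_forms)

section \<open>Dimensions of graded pieces of a quotient\<close>

lemma quot_ring_simps:
  "mult (quot_alg V I) = rcoset_mult (mpoly_ring V) I" "one (quot_alg V I) = I +>\<^bsub>mpoly_ring V\<^esub> 1"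
  "zero (quot_alg V I) = I" "add (quot_alg V I) = set_add (mpoly_ring V)"
  by (simp_all add: FactRing_def)

lemma quot_proj_hom:
  "ideal I (mpoly_ring V) \<Longrightarrow> ring_hom_ring (mpoly_ring V) (quot_alg V I) ((+>\<^bsub>mpoly_ring V\<^esub>) I)"
  by (rule ideal.rcos_ring_hom_ring)

lemma a_r_coset_mpoly: "I +>\<^bsub>mpoly_ring V\<^esub> p = {q + p |q. q \<in> I}"
  by (auto simp: a_r_coset_def r_coset_def)

lemma quot_proj_eq_iff:
  assumes "ideal I (mpoly_ring V)"
  shows "I +>\<^bsub>mpoly_ring V\<^esub> p = I +>\<^bsub>mpoly_ring V\<^esub> q \<longleftrightarrow> p - q \<in> I"
proof
  assume "I +>\<^bsub>mpoly_ring V\<^esub> p = I +>\<^bsub>mpoly_ring V\<^esub> q"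
  moreover have "p \<in> I +>\<^bsub>mpoly_ring V\<^esub> p"
    using assms by (auto simp: a_r_coset_mpoly ideal_mpoly_ring_iff intro!: exI[of _ 0])
  ultimately show "p - q \<in> I"
    by (auto simp: a_r_coset_mpoly)
next
  have sub: "{r + p |r. r \<in> I} \<subseteq> {r + q |r. r \<in> I}" if "p - q \<in> I" for p q
  proof
    fix x assume "x \<in> {r + p |r. r \<in> I}"
    then obtain r where "r \<in> I" "x = r + p"
      by blast
    then show "x \<in> {r + q |r. r \<in> I}"
      using assms that unfolding ideal_mpoly_ring_iff
      by (intro CollectI exI[of _ "r + (p - q)"]) auto
  qed
  assume "p - q \<in> I"
  moreover from this have "q - p \<in> I"
    using ideal_uminus_mpoly[OF assms] by fastforce
  ultimately show "I +>\<^bsub>mpoly_ring V\<^esub> p = I +>\<^bsub>mpoly_ring V\<^esub> q"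
    using sub by (simp add: a_r_coset_mpoly subset_antisym)
qed

lemma proper_ideal_iff:
  "ideal I (mpoly_ring V) \<Longrightarrow> I = carrier (mpoly_ring V) \<longleftrightarrow> 1 \<in> I"
  by (auto simp: ideal_mpoly_ring_iff) (metis mult.right_neutral subsetD)

text \<open>The constants form a field inside the polynomial ring, and a ring homomorphism maps it
  onto a field as soon as 1 and 0 stay distinct, which is the properness of
  \<open>I\<close>.\<close>

lemma subfield_scalars:
  assumes I: "ideal I (mpoly_ring V)" and ne: "I \<noteq> carrier (mpoly_ring V)"
  shows "subfield (scalars V (I :: 'k::field mpoly set)) (quot_alg V I)"
proof -
  interpret P: cring "mpoly_ring V :: 'k mpoly ring"
    by (rule cring_mpoly_ring)
  interpret h: ring_hom_ring "mpoly_ring V" "quot_alg V I" "(+>\<^bsub>mpoly_ring V\<^esub>) I"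
    by (rule quot_proj_hom[OF I])
  have inj: "const a = const b \<longleftrightarrow> a = b" for a b :: 'k
    by (metis const_def lookup_single_eq)
  have "subring (range (const :: 'k \<Rightarrow> 'k mpoly)) (mpoly_ring V)"
    by (rule P.subringI) (auto simp flip: const_simps)
  then have "subcring (range (const :: 'k \<Rightarrow> 'k mpoly)) (mpoly_ring V)"
    by (rule P.subcringI) (auto simp: mult.commute)
  then have "subfield (range (const :: 'k \<Rightarrow> 'k mpoly)) (mpoly_ring V)"
  proof (rule P.subfieldI)
    have "const c \<in> Units (mpoly_ring V \<lparr>carrier := range const\<rparr>)" if "c \<noteq> 0" for c :: 'k
      using that unfolding Units_def
      by (auto simp flip: const_simps simp: inj intro!: exI[of _ "inverse c"])
    then show "Units (mpoly_ring V \<lparr>carrier := range const\<rparr>) = range (const :: 'k \<Rightarrow> 'k mpoly) - {\<zero>\<^bsub>mpoly_ring V\<^esub>}"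
      by (auto simp: Units_def const_simps inj simp flip: const_simps)
  qed
  moreover have "\<one>\<^bsub>quot_alg V I\<^esub> \<noteq> \<zero>\<^bsub>quot_alg V I\<^esub>"
  proof -
    have "I +>\<^bsub>mpoly_ring V\<^esub> 0 = I"
      by (simp add: a_r_coset_mpoly)
    then show ?thesis
      using quot_proj_eq_iff[OF I, of 1 0] proper_ideal_iff[OF I] ne by (simp add: quot_ring_simps)
  qed
  ultimately have "subfield ((+>\<^bsub>mpoly_ring V\<^esub>) I ` range const) (quot_alg V I)"
    by (rule h.img_is_subfield(2))
  then show ?thesis
    by (simp add: scalars_def image_image)
qed

text \<open>\<open>Span\<close> grows by one line extension per list element, which matches
  \<open>span_insert\<close> step by step.\<close>

lemma Span_quot:
  assumes I: "ideal I (mpoly_ring V)" and "set us \<subseteq> carrier (mpoly_ring V)"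
  shows "ring.Span (quot_alg V I) (scalars V I) (map ((+>\<^bsub>mpoly_ring V\<^esub>) I) us) =
    (+>\<^bsub>mpoly_ring V\<^esub>) I ` mpoly.span (set us)"
  using assms(2)
proof (induction us)
  interpret h: ring_hom_ring "mpoly_ring V" "quot_alg V I" "(+>\<^bsub>mpoly_ring V\<^esub>) I"
    by (rule quot_proj_hom[OF I])
  case Nil
  then show ?case
    using h.hom_zero by simp
next
  interpret h: ring_hom_ring "mpoly_ring V" "quot_alg V I" "(+>\<^bsub>mpoly_ring V\<^esub>) I"
    by (rule quot_proj_hom[OF I])
  let ?\<pi> = "(+>\<^bsub>mpoly_ring V\<^esub>) I"
  case (Cons u us)
  have sub: "mpoly.span (set us) \<subseteq> carrier (mpoly_ring V)"
    using Cons.prems by (intro mpoly.span_minimal subspace_carrier) simp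
  have hom: "?\<pi> (const c) \<otimes>\<^bsub>quot_alg V I\<^esub> ?\<pi> u \<oplus>\<^bsub>quot_alg V I\<^esub> ?\<pi> v = ?\<pi> (const c * u + v)"
    if "v \<in> mpoly.span (set us)" for c v
    using Cons.prems sub that h.hom_mult[of "const c" u] h.hom_add[of "const c * u" v]
      carrier_mpoly_ring_mult[of "const c" V u] by auto
  have "ring.Span (quot_alg V I) (scalars V I) (map ?\<pi> (u # us)) =
      ring.line_extension (quot_alg V I) (scalars V I) (?\<pi> u) (?\<pi> ` mpoly.span (set us))"
    using Cons by simp
  also have "\<dots> = {?\<pi> (const c * u + v) |c v. v \<in> mpoly.span (set us)}"
    by (auto simp: h.S.line_extension_mem_iff scalars_def hom; blast)
  also have "\<dots> = ?\<pi> ` mpoly.span (set (u # us))"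
    unfolding list.set mpoly.span_insert image_def
  proof (intro Collect_cong iffI; clarify)
    fix c v assume "v \<in> mpoly.span (set us)"
    then show "\<exists>x\<in>{x. \<exists>k. x - const k * u \<in> mpoly.span (set us)}. ?\<pi> (const c * u + v) = ?\<pi> x"
      by (intro bexI[of _ "const c * u + v"]) (auto intro!: exI[of _ c])
  next
    fix x k assume "x - const k * u \<in> mpoly.span (set us)"
    then show "\<exists>c v. ?\<pi> x = ?\<pi> (const c * u + v) \<and> v \<in> mpoly.span (set us)"
      by (intro exI[of _ k] exI[of _ "x - const k * u"]) simp
  qed
  finally show ?case .
qed

text \<open>For \<open>I = R\<close> the scalars form the zero ring, which is not a subfield, so that uniqueness of
  dimensions has to be checked by hand.\<close>

lemma dim_quot_improper:
  assumes I: "ideal I (mpoly_ring V)" and "1 \<in> I" "U \<subseteq> carrier (mpoly_ring V)" "U \<noteq> {}"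
  shows "ring.dim (quot_alg V I) (scalars V I) ((+>\<^bsub>mpoly_ring V\<^esub>) I ` U) = 0"
proof -
  interpret h: ring_hom_ring "mpoly_ring V" "quot_alg V I" "(+>\<^bsub>mpoly_ring V\<^esub>) I"
    by (rule quot_proj_hom[OF I])
  have all: "I +>\<^bsub>mpoly_ring V\<^esub> p = I" if "p \<in> carrier (mpoly_ring V)" for p
    using that quot_proj_eq_iff[OF I, of p 0] proper_ideal_iff[OF I] assms(2)
    by (simp add: a_r_coset_mpoly)
  have carr: "carrier (quot_alg V I) = {I}"
    using all h.R.zero_closed by (force simp: FactRing_def A_RCOSETS_def')
  have zero: "E = {\<zero>\<^bsub>quot_alg V I\<^esub>} \<and> n = 0" if "h.S.dimension n (scalars V I) E" for n E
    using that carr by induction (auto simp: quot_ring_simps)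
  have "I +>\<^bsub>mpoly_ring V\<^esub> p = \<zero>\<^bsub>quot_alg V I\<^esub>" if "p \<in> U" for p
    using all that assms(3) unfolding quot_ring_simps by blast
  then have eq: "(+>\<^bsub>mpoly_ring V\<^esub>) I ` U = {\<zero>\<^bsub>quot_alg V I\<^esub>}"
    using assms(4) by blast
  show ?thesis
    unfolding h.S.dim_def eq
  proof (rule the_equality)
    show "h.S.dimension 0 (scalars V I) {\<zero>\<^bsub>quot_alg V I\<^esub>}"
      by (rule h.S.dimension.zero_dim)
  qed (use zero in blast)
qed

text \<open>A basis \<open>B\<close> of \<open>U \<inter> I\<close> is extended to a basis
  \<open>C\<close> of \<open>U\<close>; the classes of \<open>C - B\<close> then form a basis of the
  image. The unit ideal is covered as well: its Hilbert function occurs later, and properness of the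
  constructed ideal is itself read off from a Hilbert function.\<close>

lemma dim_quot_image:
  assumes I: "ideal I (mpoly_ring V)" and U: "mpoly.subspace U" "U \<subseteq> carrier (mpoly_ring V)"
    and fin: "U \<subseteq> mpoly.span F" "finite F"
  shows "ring.dim (quot_alg V I) (scalars V I) ((+>\<^bsub>mpoly_ring V\<^esub>) I ` U) =
    mpoly.dim U - mpoly.dim (U \<inter> I)"
proof (cases "I = carrier (mpoly_ring V)")
  case True
  moreover have "U \<noteq> {}"
    using U(1) mpoly.subspace_0 by blast
  ultimately show ?thesis
    using dim_quot_improper[OF I _ U(2)] proper_ideal_iff[OF I] U(2) by (simp add: Int_absorb2)
next
  case False
  interpret h: ring_hom_ring "mpoly_ring V" "quot_alg V I" "(+>\<^bsub>mpoly_ring V\<^esub>) I"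
    by (rule quot_proj_hom[OF I])
  let ?\<pi> = "(+>\<^bsub>mpoly_ring V\<^esub>) I" and ?S = "scalars V I"
  have "mpoly.subspace (U \<inter> I)"
    using U(1) subspace_ideal[OF I] by (rule mpoly.subspace_inter)
  then obtain B C where BC: "B \<subseteq> C" "finite C" "mpoly.independent B" "mpoly.independent C"
      "mpoly.span B = U \<inter> I" "mpoly.span C = U" "card B = mpoly.dim (U \<inter> I)" "card C = mpoly.dim U"
    by (rule mpoly.finite_basis_extension[OF _ U(1) Int_lower1 fin])
  have CU: "C \<subseteq> U"
    using BC(6) mpoly.span_superset by blast
  obtain us where us: "set us = C - B" "distinct us"
    using finite_distinct_list[of "C - B"] BC(2) by auto
  have "h.S.independent ?S (map ?\<pi> vs)" if "set vs \<subseteq> C - B" "distinct vs" for vs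
    using that
  proof (induction vs)
    case (Cons v vs)
    have v: "v \<in> C" "v \<notin> B" "v \<notin> set vs" "set vs \<subseteq> C - B"
      using Cons.prems by auto
    \<comment> \<open>Otherwise some \<open>v - w\<close> would lie in
      \<open>U \<inter> I = span B\<close>, making \<open>v\<close> dependent on the other elements
      of \<open>C\<close>.\<close>
    have "?\<pi> v \<notin> ?\<pi> ` mpoly.span (set vs)"
    proof
      assume "?\<pi> v \<in> ?\<pi> ` mpoly.span (set vs)"
      then obtain w where w: "w \<in> mpoly.span (set vs)" "v - w \<in> I"
        using quot_proj_eq_iff[OF I] by auto
      have "w \<in> mpoly.span C"
        using w(1) v(4) mpoly.span_mono[of "set vs" C] by auto
      then have "v - w \<in> U"
        using BC(6) v(1) mpoly.span_base mpoly.span_diff by blast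
      then have "v - w \<in> mpoly.span B"
        using w(2) BC(5) by simp
      moreover have "mpoly.span B \<subseteq> mpoly.span (C - {v})" "mpoly.span (set vs) \<subseteq> mpoly.span (C - {v})"
        using v BC(1) by (auto intro!: mpoly.span_mono)
      ultimately have "(v - w) + w \<in> mpoly.span (C - {v})"
        using w(1) by (intro mpoly.span_add) auto
      then show False
        using BC(4) v(1) mpoly.dependent_def by fastforce
    qed
    moreover have "set vs \<subseteq> carrier (mpoly_ring V)" "v \<in> carrier (mpoly_ring V)"
      using v CU U(2) by auto
    ultimately show ?case
      using Cons Span_quot[OF I, of vs] h.hom_closed[of v]
      by (auto intro!: h.S.independent.li_Cons simp del: h.S.Span.simps)
  qed simp
  then have "h.S.independent ?S (map ?\<pi> us)"
    using us by simp
  then have "h.S.dimension (length us) ?S (h.S.Span ?S (map ?\<pi> us))"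
    using h.S.dimension_independent by fastforce
  moreover have "h.S.Span ?S (map ?\<pi> us) = ?\<pi> ` U"
  proof -
    have "set us \<subseteq> carrier (mpoly_ring V)"
      using us CU U(2) by auto
    moreover have "?\<pi> ` mpoly.span (C - B) = ?\<pi> ` U"
    proof (rule subset_antisym)
      show "?\<pi> ` mpoly.span (C - B) \<subseteq> ?\<pi> ` U"
        using BC(6) mpoly.span_mono[of "C - B" C] by auto
    next
      show "?\<pi> ` U \<subseteq> ?\<pi> ` mpoly.span (C - B)"
      proof
      fix x assume "x \<in> ?\<pi> ` U"
      then obtain p where p: "p \<in> mpoly.span ((C - B) \<union> B)" "x = ?\<pi> p"
        using BC(1,6) by (auto simp: Un_absorb2)
      then obtain q r where qr: "p = q + r" "q \<in> mpoly.span (C - B)" "r \<in> mpoly.span B"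
        unfolding mpoly.span_Un by blast
      then have "?\<pi> p = ?\<pi> q"
        using BC(5) by (simp add: quot_proj_eq_iff[OF I])
      then show "x \<in> ?\<pi> ` mpoly.span (C - B)"
        using p qr by blast
      qed
    qed
    ultimately show ?thesis
      using Span_quot[OF I] us(1) by simp
  qed
  ultimately have "(h.S.dim over ?S) (?\<pi> ` U) = length us"
    using h.S.dimI[OF subfield_scalars[OF I False]] by simp
  moreover have "length us = card C - card B"
    using us BC(1,2) distinct_card[of us] card_Diff_subset[of B C] finite_subset by metis
  ultimately show ?thesis
    using BC(7,8) by (simp add: over_def)
qed

lemma hilbert_eq:
  fixes I :: "'k::field mpoly set"
  assumes "ideal I (mpoly_ring V)" "finite V"
  shows "hilbert V I t = mpoly.dim (forms V t :: 'k mpoly set) - mpoly.dim (forms V t \<inter> I)"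
  unfolding hilbert_def graded_part_def
  by (rule dim_quot_image[OF assms(1) subspace_forms forms_subset_carrier forms_finite_dim
      finite_monomials_upto[OF assms(2)]])

section \<open>Expansion in powers of a variable\<close>

text \<open>\<open>slice v j p\<close> is the coefficient of \<open>x\<^sub>v^j\<close> in \<open>p\<close>, and \<open>shift v p\<close> the quotient of \<open>p\<close>
  by \<open>x\<^sub>v\<close> with the \<open>x\<^sub>v\<close>-free terms discarded.\<close>

lift_definition slice :: "nat \<Rightarrow> nat \<Rightarrow> 'k::field mpoly \<Rightarrow> 'k mpoly"
  is "\<lambda>v j p m. if Poly_Mapping.lookup m v = 0 then p (m + Poly_Mapping.single v j) else 0"
proof -
  fix v j and p :: "(nat \<Rightarrow>\<^sub>0 nat) \<Rightarrow> 'k"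
  assume "finite {m. p m \<noteq> 0}"
  \<comment> \<open>Every exponent in the new support arises from one in the old support by
    subtracting \<open>single v j\<close>.\<close>
  then have "finite ((\<lambda>m. m - Poly_Mapping.single v j) ` {m. p m \<noteq> 0})"
    by simp
  then show "finite {m. (if Poly_Mapping.lookup m v = 0 then p (m + Poly_Mapping.single v j) else 0) \<noteq> 0}"
    by (rule rev_finite_subset) (force simp: image_iff split: if_splits)
qed

lift_definition shift :: "nat \<Rightarrow> 'k::field mpoly \<Rightarrow> 'k mpoly"
  is "\<lambda>v p m. p (m + Poly_Mapping.single v 1)"
proof -
  fix v and p :: "(nat \<Rightarrow>\<^sub>0 nat) \<Rightarrow> 'k"
  assume "finite {m. p m \<noteq> 0}"
  then have "finite ((\<lambda>m. m - Poly_Mapping.single v 1) ` {m. p m \<noteq> 0})"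
    by simp
  then show "finite {m. p (m + Poly_Mapping.single v 1) \<noteq> 0}"
    by (rule rev_finite_subset) (force simp: image_iff)
qed

lemma slice_add: "slice v j (p + q) = slice v j p + slice v j q"
  by (rule poly_mapping_eqI) (simp add: slice.rep_eq lookup_add)

lemma slice_zero [simp]: "slice v j 0 = 0"
  by (rule poly_mapping_eqI) (simp add: slice.rep_eq)

lemma slice_sum: "slice v j (sum f T) = (\<Sum>i\<in>T. slice v j (f i))"
  by (induction T rule: infinite_finite_induct) (auto simp: slice_add)

lemma slice_shift: "slice v j (shift v p) = slice v (Suc j) p"
  by (rule poly_mapping_eqI) (simp add: slice.rep_eq shift.rep_eq add.assoc flip: single_add)

lemma lookup_var_times: "Poly_Mapping.lookup (var v * p) m =
    (if Poly_Mapping.lookup m v = 0 then 0 else Poly_Mapping.lookup p (m - Poly_Mapping.single v 1))"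
  by (auto simp: var_def lookup_single_times lookup_single when_def)

lemma single_le_imp_add:
  assumes "Poly_Mapping.lookup m v \<noteq> (0 :: nat)"
  shows "m - Poly_Mapping.single v 1 + Poly_Mapping.single v 1 = m"
  using assms by (intro poly_mapping_eqI) (auto simp: lookup_add lookup_minus lookup_single when_def)

lemma slice_var_times: "slice v j (var v * p) = (if j = 0 then 0 else slice v (j - 1) p)"
proof (rule poly_mapping_eqI)
  fix m
  have "m + Poly_Mapping.single v j - Poly_Mapping.single v 1 = m + Poly_Mapping.single v (j - 1)"
    if "j \<noteq> 0"
    using that by (intro poly_mapping_eqI) (auto simp: lookup_add lookup_minus lookup_single when_def)
  then show "Poly_Mapping.lookup (slice v j (var v * p)) m =
      Poly_Mapping.lookup (if j = 0 then 0 else slice v (j - 1) p) m"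
    by (simp add: slice.rep_eq lookup_var_times lookup_add)
qed

lemma shift_var_times: "shift v (var v * p) = p"
  by (rule poly_mapping_eqI) (simp add: shift.rep_eq lookup_var_times lookup_add)

text \<open>The Horner step in \<open>x\<^sub>v\<close>, on which the inductions below rest.\<close>

lemma slice_shift_decomp: "p = slice v 0 p + var v * shift v p"
proof (rule poly_mapping_eqI)
  fix m
  show "Poly_Mapping.lookup p m = Poly_Mapping.lookup (slice v 0 p + var v * shift v p) m"
    using single_le_imp_add[of m v] by (simp add: lookup_add slice.rep_eq lookup_var_times shift.rep_eq)
qed

lemma slice_carrier:
  assumes "p \<in> carrier (mpoly_ring (insert v V))"
  shows "slice v j p \<in> carrier (mpoly_ring V)"
proof -
  have "Poly_Mapping.keys m \<subseteq> V"
    if "Poly_Mapping.lookup m v = 0" "Poly_Mapping.lookup p (m + Poly_Mapping.single v j) \<noteq> 0" for m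
  proof -
    have "Poly_Mapping.keys m \<subseteq> insert v V"
      using assms that(2) keys_add_nat[of m] by (auto simp: mem_carrier_mpoly_ring)
    then show ?thesis
      using that(1) by (auto simp: in_keys_iff)
  qed
  then show ?thesis
    by (simp add: mem_carrier_mpoly_ring slice.rep_eq)
qed

lemma shift_carrier:
  assumes "p \<in> carrier (mpoly_ring V)"
  shows "shift v p \<in> carrier (mpoly_ring V)"
  unfolding mem_carrier_mpoly_ring shift.rep_eq
proof (intro allI impI)
  fix m assume "Poly_Mapping.lookup p (m + Poly_Mapping.single v 1) \<noteq> 0"
  then have "Poly_Mapping.keys (m + Poly_Mapping.single v 1) \<subseteq> V"
    using assms by (simp add: mem_carrier_mpoly_ring)
  then show "Poly_Mapping.keys m \<subseteq> V"
    by (simp add: keys_add_nat)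
qed

lemma slice_of_carrier:
  assumes "p \<in> carrier (mpoly_ring V)" "v \<notin> V"
  shows "slice v j p = (if j = 0 then p else 0)"
proof (rule poly_mapping_eqI)
  fix m
  have "v \<notin> Poly_Mapping.keys k" if "Poly_Mapping.lookup p k \<noteq> 0" for k
    using assms that unfolding mem_carrier_mpoly_ring by blast
  then have "Poly_Mapping.lookup p k = 0" if "Poly_Mapping.lookup k v \<noteq> 0" for k
    using that in_keys_iff by metis
  note free = this[of m] this[of "m + Poly_Mapping.single v j"]
  show "Poly_Mapping.lookup (slice v j p) m = Poly_Mapping.lookup (if j = 0 then p else 0) m"
  proof (cases "j = 0")
    case True
    then show ?thesis
      using free(1) by (simp add: slice.rep_eq)
  next
    case False
    then show ?thesis
      using free(2) by (simp add: slice.rep_eq lookup_add)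
  qed
qed

text \<open>A factor free of \<open>x\<^sub>v\<close> acts on each coefficient of the expansion
  separately. By linearity in \<open>q\<close> it suffices to treat monomials.\<close>

lemma slice_times_carrier:
  assumes "q \<in> carrier (mpoly_ring V)" "v \<notin> V"
  shows "slice v j (q * p) = q * slice v j p"
proof -
  let ?s = "\<lambda>m. Poly_Mapping.single m (Poly_Mapping.lookup q m)"
  have q: "q = (\<Sum>m\<in>Poly_Mapping.keys q. ?s m)"
    by (rule sum_singles)
  have mono: "slice v j (Poly_Mapping.single a c * p) = Poly_Mapping.single a c * slice v j p"
    if a: "Poly_Mapping.lookup a v = 0" for a c
  proof (rule poly_mapping_eqI)
    fix m
    \<comment> \<open>Since \<open>a\<close> has exponent 0 at \<open>v\<close>, the extra power of
      \<open>x\<^sub>v\<close> does not affect divisibility by \<open>a\<close>.\<close>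
    have le: "(\<forall>i. Poly_Mapping.lookup a i \<le> Poly_Mapping.lookup (m + Poly_Mapping.single v j) i) \<longleftrightarrow>
        (\<forall>i. Poly_Mapping.lookup a i \<le> Poly_Mapping.lookup m i)" if "Poly_Mapping.lookup m v = 0"
    proof -
      have "Poly_Mapping.lookup a i \<le> Poly_Mapping.lookup (m + Poly_Mapping.single v j) i \<longleftrightarrow>
          Poly_Mapping.lookup a i \<le> Poly_Mapping.lookup m i" for i
        using a that by (cases "i = v") (simp_all add: lookup_add lookup_single when_def)
      then show ?thesis
        by simp
    qed
    have diff: "m + Poly_Mapping.single v j - a = m - a + Poly_Mapping.single v j"
      if "\<forall>i. Poly_Mapping.lookup a i \<le> Poly_Mapping.lookup m i"
      using that by (intro poly_mapping_eqI) (simp add: lookup_add lookup_minus)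
    show "Poly_Mapping.lookup (slice v j (Poly_Mapping.single a c * p)) m =
        Poly_Mapping.lookup (Poly_Mapping.single a c * slice v j p) m"
    proof (cases "Poly_Mapping.lookup m v = 0")
      case True
      show ?thesis
        using a le[OF True] diff True by (simp add: slice.rep_eq lookup_single_times lookup_minus)
    next
      case False
      then show ?thesis
        using a by (simp add: slice.rep_eq lookup_single_times lookup_minus)
    qed
  qed
  have "slice v j (q * p) = (\<Sum>m\<in>Poly_Mapping.keys q. slice v j (?s m * p))"
    by (subst q) (simp add: sum_distrib_right slice_sum)
  also have "\<dots> = (\<Sum>m\<in>Poly_Mapping.keys q. ?s m * slice v j p)"
  proof (rule sum.cong)
    fix m assume "m \<in> Poly_Mapping.keys q"
    then have "v \<notin> Poly_Mapping.keys m"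
      using assms by (auto simp: mpoly_ring_def)
    then have "Poly_Mapping.lookup m v = 0"
      by (simp add: in_keys_iff)
    then show "slice v j (?s m * p) = ?s m * slice v j p"
      by (rule mono)
  qed simp
  also have "\<dots> = q * slice v j p"
    by (subst (3) q) (simp add: sum_distrib_right)
  finally show ?thesis .
qed

text \<open>No monomial of degree \<open>t\<close> contains \<open>x\<^sub>v^j\<close> with
  \<open>j > t\<close>; without the guard the truncated difference \<open>t - j\<close> would select
  the component of degree 0.\<close>

lemma slice_hcomponent:
  "slice v j (hcomponent t p) = (if j \<le> t then hcomponent (t - j) (slice v j p) else 0)"
  by (rule poly_mapping_eqI) (auto simp: slice.rep_eq lookup_hcomponent mdeg_add)

subsection \<open>Extension of an ideal to a polynomial ring with one more variable\<close>

text \<open>The extension of \<open>J\<close> to the larger ring, described by coefficients instead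
  of generators so that membership can be tested slice by slice; \<open>genideal_ext_ideal\<close>
  identifies it with the generated ideal.\<close>

definition ext_ideal :: "nat \<Rightarrow> nat set \<Rightarrow> 'k::field mpoly set \<Rightarrow> 'k mpoly set"
  where "ext_ideal v V J = {p \<in> carrier (mpoly_ring (insert v V)). \<forall>j. slice v j p \<in> J}"

lemma ext_ideal_carrier: "ext_ideal v V (carrier (mpoly_ring V)) = carrier (mpoly_ring (insert v V))"
  by (auto simp: ext_ideal_def slice_carrier)

lemma mem_ext_ideal_base:
  assumes p: "p \<in> carrier (mpoly_ring V)" and v: "v \<notin> V" and J: "ideal J (mpoly_ring V)"
  shows "p \<in> ext_ideal v V J \<longleftrightarrow> p \<in> J"
proof -
  have "p \<in> carrier (mpoly_ring (insert v V))"
    using p carrier_mpoly_ring_mono[of V "insert v V"] by blast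
  then show ?thesis
    using J by (simp add: ext_ideal_def slice_of_carrier[OF p v] ideal_mpoly_ring_iff)
qed

text \<open>Induction on a strict bound \<open>N\<close> for the exponents of
  \<open>x\<^sub>v\<close>, which \<open>shift\<close> lowers by one. For \<open>N = 0\<close> no
  monomial is left, so the base case is the zero polynomial.\<close>

lemma carrier_induct_shift [consumes 1, case_names zero step]:
  assumes p: "p \<in> carrier (mpoly_ring (insert v V))"
    and base: "P 0"
    and step: "\<And>p. p \<in> carrier (mpoly_ring (insert v V)) \<Longrightarrow> P (shift v p) \<Longrightarrow> P p"
  shows "P p"
proof -
  obtain N where "\<forall>m. Poly_Mapping.lookup p m \<noteq> 0 \<longrightarrow> Poly_Mapping.lookup m v < N"
    using finite_nat_set_iff_bounded[of "(\<lambda>m. Poly_Mapping.lookup m v) ` Poly_Mapping.keys p"]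
    by (metis finite_imageI finite_keys imageI in_keys_iff)
  then show ?thesis
    using p
  proof (induction N arbitrary: p)
    case 0
    then have "p = 0"
      by (intro poly_mapping_eqI) auto
    then show ?case
      using base by simp
  next
    case (Suc N)
    have "\<forall>m. Poly_Mapping.lookup (shift v p) m \<noteq> 0 \<longrightarrow> Poly_Mapping.lookup m v < N"
    proof (intro allI impI)
      fix m assume "Poly_Mapping.lookup (shift v p) m \<noteq> 0"
      then have "Poly_Mapping.lookup (m + Poly_Mapping.single v 1) v < Suc N"
        using Suc.prems(1) by (simp add: shift.rep_eq)
      then show "Poly_Mapping.lookup m v < N"
        by (simp add: lookup_add)
    qed
    then show ?case
      using Suc.IH Suc.prems(2) shift_carrier step by blast
  qed
qed

text \<open>Absorption is shown by Horner induction on the multiplier: its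
  \<open>x\<^sub>v\<close>-free part multiplies every slice by an element of the ring of
  \<open>J\<close>, and \<open>x\<^sub>v\<close> merely moves the slices up.\<close>

lemma ideal_ext_ideal:
  fixes J :: "'k::field mpoly set"
  assumes J: "ideal J (mpoly_ring V)" and v: "v \<notin> V"
  shows "ideal (ext_ideal v V J) (mpoly_ring (insert v V))"
  unfolding ideal_mpoly_ring_iff
proof (intro conjI ballI)
  show "ext_ideal v V J \<subseteq> carrier (mpoly_ring (insert v V))"
    by (auto simp: ext_ideal_def)
  show "0 \<in> ext_ideal v V J"
    using J by (simp add: ext_ideal_def ideal_mpoly_ring_iff)
  show add: "p + q \<in> ext_ideal v V J" if "p \<in> ext_ideal v V J" "q \<in> ext_ideal v V J" for p q
    using that J by (simp add: ext_ideal_def ideal_mpoly_ring_iff slice_add carrier_mpoly_ring_add)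
  fix r p :: "'k mpoly" assume r: "r \<in> carrier (mpoly_ring (insert v V))" and p: "p \<in> ext_ideal v V J"
  show "r * p \<in> ext_ideal v V J"
    using r
  proof (induction r rule: carrier_induct_shift)
    case zero
    show ?case
      using J by (simp add: ext_ideal_def ideal_mpoly_ring_iff)
  next
    case (step r)
    have "slice v 0 r * p \<in> ext_ideal v V J"
      using p slice_carrier[OF step(1)] J carrier_mpoly_ring_mono[of V "insert v V"]
      by (auto simp: ext_ideal_def ideal_mpoly_ring_iff slice_times_carrier[OF _ v]
          intro!: carrier_mpoly_ring_mult)
    moreover have "var v * (shift v r * p) \<in> ext_ideal v V J"
      using step(2) J unfolding ext_ideal_def
      by (auto simp: slice_var_times ideal_mpoly_ring_iff carrier_mpoly_ring_mult carrier_mpoly_ring_var)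
    ultimately have "slice v 0 r * p + var v * (shift v r * p) \<in> ext_ideal v V J"
      by (rule add)
    also have "slice v 0 r * p + var v * (shift v r * p) = (slice v 0 r + var v * shift v r) * p"
      by (simp add: algebra_simps)
    also have "\<dots> = r * p"
      using slice_shift_decomp[of r v] by simp
    finally show ?case .
  qed
qed

text \<open>Elements of \<open>J\<close> have no slices beyond slice 0, so the explicit ideal
  contains \<open>J\<close>. Conversely, Horner induction rebuilds a polynomial from its slices
  inside the generated ideal.\<close>

lemma genideal_ext_ideal:
  assumes J: "ideal J (mpoly_ring V)" and v: "v \<notin> V"
  shows "Idl\<^bsub>mpoly_ring (insert v V)\<^esub> J = ext_ideal v V J"
proof (rule subset_antisym)
  interpret R: ring "mpoly_ring (insert v V)"
    by (rule ring_mpoly_ring)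
  have JV: "J \<subseteq> carrier (mpoly_ring V)"
    using J by (simp add: ideal_mpoly_ring_iff)
  have JW: "J \<subseteq> carrier (mpoly_ring (insert v V))"
    using JV carrier_mpoly_ring_mono[of V "insert v V"] by blast
  have "J \<subseteq> ext_ideal v V J"
    using JV mem_ext_ideal_base[OF _ v J] by blast
  then show "Idl\<^bsub>mpoly_ring (insert v V)\<^esub> J \<subseteq> ext_ideal v V J"
    by (rule R.genideal_minimal[OF ideal_ext_ideal[OF J v]])
  let ?G = "Idl\<^bsub>mpoly_ring (insert v V)\<^esub> J"
  have G: "ideal ?G (mpoly_ring (insert v V))"
    using JW by (rule R.genideal_ideal)
  have "(\<forall>j. slice v j p \<in> J) \<longrightarrow> p \<in> ?G" if "p \<in> carrier (mpoly_ring (insert v V))" for p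
    using that
  proof (induction p rule: carrier_induct_shift)
    case zero
    show ?case
      using G by (simp add: ideal_mpoly_ring_iff)
  next
    case (step p)
    show ?case
    proof
      assume sl: "\<forall>j. slice v j p \<in> J"
      then have "shift v p \<in> ?G"
        using step(2) by (simp add: slice_shift)
      moreover have "slice v 0 p \<in> ?G"
        using sl R.genideal_self[OF JW] by blast
      ultimately have "slice v 0 p + var v * shift v p \<in> ?G"
        using G by (simp add: ideal_mpoly_ring_iff carrier_mpoly_ring_var)
      then show "p \<in> ?G"
        using slice_shift_decomp[of p v] by simp
    qed
  qed
  then show "ext_ideal v V J \<subseteq> ?G"
    by (auto simp: ext_ideal_def)
qed

lemma homogeneous_ext_ideal:
  assumes "homogeneous_ideal V J" "v \<notin> V"
  shows "homogeneous_ideal (insert v V) (ext_ideal v V J)"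
  using assms ideal_ext_ideal[of J V v] hcomponent_forms[of _ "insert v V"] forms_subset_carrier[of "insert v V"]
  unfolding homogeneous_ideal_def
  by (auto simp: ext_ideal_def slice_hcomponent ideal_mpoly_ring_iff)

text \<open>The nonzerodivisor property: \<open>var v\<close> shifts the slices by one place and
  inserts 0, which lies in \<open>J\<close>, so the conditions on the slices stay the same.\<close>

lemma var_power_times_ext_ideal_iff:
  assumes "p \<in> carrier (mpoly_ring (insert v V))" "ideal J (mpoly_ring V)"
  shows "var v ^ d * p \<in> ext_ideal v V J \<longleftrightarrow> p \<in> ext_ideal v V J"
  using assms(1)
proof (induction d)
  case (Suc d)
  let ?q = "var v ^ d * p"
  have q: "?q \<in> carrier (mpoly_ring (insert v V))"
    using Suc.prems forms_subset_carrier var_power_form[of v "insert v V" d]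
    by (intro carrier_mpoly_ring_mult) auto
  have "(\<forall>j. slice v j (var v * ?q) \<in> J) \<longleftrightarrow> (\<forall>j. slice v j ?q \<in> J)"
  proof
    assume *: "\<forall>j. slice v j (var v * ?q) \<in> J"
    show "\<forall>j. slice v j ?q \<in> J"
      using *[rule_format, of "Suc _"] by (simp add: slice_var_times)
  next
    assume "\<forall>j. slice v j ?q \<in> J"
    then show "\<forall>j. slice v j (var v * ?q) \<in> J"
      using assms(2) by (simp add: slice_var_times ideal_mpoly_ring_iff)
  qed
  then have "var v * ?q \<in> ext_ideal v V J \<longleftrightarrow> ?q \<in> ext_ideal v V J"
    using q by (auto simp: ext_ideal_def carrier_mpoly_ring_mult carrier_mpoly_ring_var)
  then show ?case
    using Suc by (simp add: mult.assoc)
qed simp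

lemma shift_forms:
  assumes "p \<in> forms V (Suc t)"
  shows "shift v p \<in> forms V t"
  unfolding mem_forms shift.rep_eq
proof (intro allI impI)
  fix m assume "Poly_Mapping.lookup p (m + Poly_Mapping.single v 1) \<noteq> 0"
  then have "Poly_Mapping.keys (m + Poly_Mapping.single v 1) \<subseteq> V \<and> mdeg (m + Poly_Mapping.single v 1) = Suc t"
    using assms by (simp add: mem_forms)
  then show "Poly_Mapping.keys m \<subseteq> V \<and> mdeg m = t"
    by (simp add: keys_add_nat mdeg_add)
qed

lemma slice_zero_forms:
  assumes "p \<in> forms (insert v V) t"
  shows "slice v 0 p \<in> forms V t"
  using slice_carrier[of p v V 0] assms
  by (simp add: mem_forms mem_carrier_mpoly_ring slice.rep_eq)

lemma forms_ext_ideal_zero: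
  assumes J: "ideal J (mpoly_ring V)" and v: "v \<notin> V"
  shows "forms (insert v V) 0 \<inter> ext_ideal v V J = forms V 0 \<inter> J"
proof -
  have "Poly_Mapping.keys m = {}" if "mdeg m = 0" for m
    using that lookup_le_mdeg[of m] by (simp add: set_eq_iff in_keys_iff)
  then have "Poly_Mapping.keys m \<subseteq> insert v V \<and> mdeg m = 0 \<longleftrightarrow> Poly_Mapping.keys m \<subseteq> V \<and> mdeg m = 0" for m
    by blast
  then have eq: "forms (insert v V) 0 = forms V 0"
    unfolding set_eq_iff mem_forms by simp
  have "p \<in> ext_ideal v V J \<longleftrightarrow> p \<in> J" if "p \<in> forms V 0" for p
    using that forms_subset_carrier by (intro mem_ext_ideal_base[OF _ v J]) blast
  then show ?thesis
    using eq by blast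
qed

text \<open>The Horner step in a fixed degree. The sum is direct and multiplication by
  \<open>var v\<close> is injective, so this is the recursion behind the dimension formula.\<close>

lemma forms_ext_ideal_Suc:
  assumes J: "ideal J (mpoly_ring V)" and v: "v \<notin> V"
  shows "forms (insert v V) (Suc t) \<inter> ext_ideal v V J =
    {x + y |x y. x \<in> (*) (var v) ` (forms (insert v V) t \<inter> ext_ideal v V J) \<and> y \<in> forms V (Suc t) \<inter> J}"
proof (intro subset_antisym subsetI)
  fix p assume p: "p \<in> forms (insert v V) (Suc t) \<inter> ext_ideal v V J"
  then have "shift v p \<in> forms (insert v V) t \<inter> ext_ideal v V J"
    by (auto simp: ext_ideal_def slice_shift shift_carrier shift_forms)
  moreover have "slice v 0 p \<in> forms V (Suc t) \<inter> J"
    using p by (auto simp: ext_ideal_def slice_zero_forms)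
  ultimately show "p \<in> {x + y |x y. x \<in> (*) (var v) ` (forms (insert v V) t \<inter> ext_ideal v V J) \<and>
      y \<in> forms V (Suc t) \<inter> J}"
    using slice_shift_decomp[of p v, unfolded add.commute[of "slice v 0 p"]] by blast
next
  fix p assume "p \<in> {x + y |x y. x \<in> (*) (var v) ` (forms (insert v V) t \<inter> ext_ideal v V J) \<and>
      y \<in> forms V (Suc t) \<inter> J}"
  then obtain x y where p: "p = var v * x + y" and x: "x \<in> forms (insert v V) t" "x \<in> ext_ideal v V J"
    and y: "y \<in> forms V (Suc t)" "y \<in> J"
    by auto
  have E: "ideal (ext_ideal v V J) (mpoly_ring (insert v V))"
    by (rule ideal_ext_ideal[OF J v])
  have yW: "y \<in> forms (insert v V) (Suc t)"
    using y(1) by (auto simp: mem_forms)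
  then have "y \<in> ext_ideal v V J"
    using y forms_subset_carrier mem_ext_ideal_base[OF _ v J] by blast
  moreover have "var v * x \<in> ext_ideal v V J"
    using E x by (simp add: ideal_mpoly_ring_iff carrier_mpoly_ring_var)
  moreover have "var v * x \<in> forms (insert v V) (Suc t)"
    using forms_times[OF var_form x(1)] by simp
  ultimately show "p \<in> forms (insert v V) (Suc t) \<inter> ext_ideal v V J"
    using p yW E mpoly.subspace_add[OF subspace_forms] by (auto simp: ideal_mpoly_ring_iff)
qed

lemma linear_times: "Vector_Spaces.linear (\<lambda>c p. const c * p) (\<lambda>c p. const c * p) ((*) (q :: 'k::field mpoly))"
  by (intro Vector_Spaces.linear_iff[THEN iffD2] conjI mpoly.vector_space_axioms)
    (simp_all add: algebra_simps)

lemma inj_var_power: "inj_on ((*) (var v ^ d :: 'k::field mpoly)) A"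
proof -
  have "inj ((*) (var v ^ d :: 'k mpoly))"
  proof (induction d)
    case (Suc d)
    have "inj ((*) (var v :: 'k mpoly))"
      using shift_var_times by (metis injI)
    then have "inj ((*) (var v :: 'k mpoly) \<circ> (*) (var v ^ d))"
      using Suc.IH by (rule inj_compose)
    then show ?case
      by (simp add: o_def mult.assoc)
  qed (simp add: inj_def)
  then show ?thesis
    by (rule inj_on_subset) simp
qed

lemma dim_forms_ext_ideal:
  fixes J :: "'k::field mpoly set"
  assumes J: "ideal J (mpoly_ring V)" and v: "v \<notin> V" and V: "finite V"
  shows "mpoly.dim (forms (insert v V) t \<inter> ext_ideal v V J) = (\<Sum>j\<le>t. mpoly.dim (forms V j \<inter> J))"
proof (induction t)
  case 0
  then show ?case
    by (simp add: forms_ext_ideal_zero[OF J v])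
next
  case (Suc t)
  let ?A = "forms (insert v V) t \<inter> ext_ideal v V J" and ?B = "forms V (Suc t) \<inter> J"
  let ?f = "(*) (var v :: 'k mpoly)"
  have A: "mpoly.subspace ?A" and B: "mpoly.subspace ?B"
    by (intro mpoly.subspace_inter subspace_forms subspace_ideal[OF J]
        subspace_ideal[OF ideal_ext_ideal[OF J v]])+
  have finA: "?A \<subseteq> mpoly.span (monomials_upto (insert v V) t)"
    using forms_finite_dim by blast
  have finB: "?B \<subseteq> mpoly.span (monomials_upto V (Suc t))"
    using forms_finite_dim by blast
  interpret f: Vector_Spaces.linear "\<lambda>c p. const c * p" "\<lambda>c p. const c * p" ?f
    by (rule linear_times)
  have fA: "mpoly.subspace (?f ` A)" if "mpoly.subspace A" for A
    using that by (rule f.subspace_image)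
  have "?f ` ?A \<subseteq> forms (insert v V) (Suc t)"
    using forms_times[OF var_form, of v "insert v V" _ t] by auto
  then have finfA: "?f ` ?A \<subseteq> mpoly.span (monomials_upto (insert v V) (Suc t))"
    using forms_finite_dim by blast
  \<comment> \<open>Slice 0 vanishes on multiples of \<open>x\<^sub>v\<close> and is the identity on
    polynomials free of \<open>x\<^sub>v\<close>.\<close>
  have "?f ` ?A \<inter> ?B \<subseteq> {0}"
  proof
    fix p assume p: "p \<in> ?f ` ?A \<inter> ?B"
    then obtain q where "p = var v * q"
      by blast
    then have "slice v 0 p = 0"
      by (simp add: slice_var_times)
    moreover have "slice v 0 p = p"
      using p slice_of_carrier[OF _ v, of p 0] forms_subset_carrier by auto
    ultimately show "p \<in> {0}"
      by simp
  qed
  then have "mpoly.dim (forms (insert v V) (Suc t) \<inter> ext_ideal v V J) = mpoly.dim (?f ` ?A) + mpoly.dim ?B"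
    unfolding forms_ext_ideal_Suc[OF J v]
    using V by (intro mpoly.dim_direct_sum[OF fA[OF A] B _ finfA _ finB])
      (simp_all add: finite_monomials_upto)
  moreover have "mpoly.dim (?f ` ?A) = mpoly.dim ?A"
    using V inj_var_power[of v 1] by (intro mpoly.dim_inj_image[OF linear_times A _ finA])
      (simp_all add: finite_monomials_upto)
  ultimately show ?case
    using Suc.IH by simp
qed

lemma ideal_carrier: "ideal (carrier (mpoly_ring V)) (mpoly_ring V)"
  by (simp add: ideal_mpoly_ring_iff carrier_mpoly_ring_add carrier_mpoly_ring_mult)

text \<open>The dimension formula for \<open>J\<close> is subtracted from the same formula for the
  unit ideal, whose extension is the whole larger ring.\<close>

lemma hilbert_ext_ideal:
  fixes J :: "'k::field mpoly set"
  assumes J: "ideal J (mpoly_ring V)" and v: "v \<notin> V" and V: "finite V"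
  shows "hilbert (insert v V) (ext_ideal v V J) t = (\<Sum>j\<le>t. hilbert V J j)"
proof -
  have *: "mpoly.dim (forms (insert v V) t :: 'k mpoly set) = (\<Sum>j\<le>t. mpoly.dim (forms V j :: 'k mpoly set))"
    using dim_forms_ext_ideal[where J = "carrier (mpoly_ring V) :: 'k mpoly set", OF ideal_carrier v V, of t]
    by (simp only: ext_ideal_carrier Int_absorb2[OF forms_subset_carrier])
  \<comment> \<open>Subtraction on \<open>nat\<close> distributes over the sum only because of this
    termwise inequality.\<close>
  have "mpoly.dim (forms V j \<inter> J) \<le> mpoly.dim (forms V j :: 'k mpoly set)" for j
    by (intro mpoly.dim_mono_fin[OF _ subspace_forms _ forms_finite_dim finite_monomials_upto[OF V]]
        mpoly.subspace_inter subspace_forms subspace_ideal[OF J]) simp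
  then show ?thesis
    using V by (simp add: hilbert_eq J ideal_ext_ideal[OF J v] * dim_forms_ext_ideal[OF J v V]
        sum_subtractf_nat)
qed

section \<open>Powers of the irrelevant ideal\<close>

lemma irrelevant_ideal_ideal: "ideal (irrelevant_ideal V) (mpoly_ring V)"
  unfolding irrelevant_ideal_def
  by (rule ring.genideal_ideal[OF ring_mpoly_ring]) (auto intro: carrier_mpoly_ring_var)

lemma irrelevant_power_ideal:
  "ideal (irrelevant_ideal V [^]\<^bsub>ideals_set (mpoly_ring V)\<^esub> (k :: nat)) (mpoly_ring V)"
proof (induction k)
  case 0
  show ?case
    by (simp add: ideals_set_def ideal_carrier)
next
  case (Suc k)
  show ?case
    using ring.ideal_prod_is_ideal[OF ring_mpoly_ring Suc irrelevant_ideal_ideal]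
    by (simp add: ideals_set_def)
qed

lemma ideal_high_degree:
  "ideal {p \<in> carrier (mpoly_ring V). \<forall>t<k. hcomponent t p = 0} (mpoly_ring V)"
  unfolding ideal_mpoly_ring_iff
proof (intro conjI ballI)
  fix r p :: "'a mpoly"
  assume r: "r \<in> carrier (mpoly_ring V)"
    and p: "p \<in> {p \<in> carrier (mpoly_ring V). \<forall>t<k. hcomponent t p = 0}"
  have "hcomponent t (hcomponent d r * p) = 0" if "t < k" for t d
  proof (cases "d \<le> t")
    case True
    then show ?thesis
      using hcomponent_form_times(1)[OF hcomponent_forms[OF r], of d "t - d" p] p that by simp
  next
    case False
    then show ?thesis
      using hcomponent_form_times(2)[OF hcomponent_forms[OF r], of t d p] by simp
  qed
  then have "hcomponent t (\<Sum>d\<in>mdeg ` Poly_Mapping.keys r. hcomponent d r * p) = 0" if "t < k" for t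
    using that by (simp add: hcomponent_sum)
  then show "r * p \<in> {p \<in> carrier (mpoly_ring V). \<forall>t<k. hcomponent t p = 0}"
    using r p sum_hcomponents[of r] by (simp add: carrier_mpoly_ring_mult flip: sum_distrib_right)
qed (auto simp: carrier_mpoly_ring_add hcomponent_add)

text \<open>Used with \<open>k = s + 1\<close>: the power of the irrelevant ideal contributes
  nothing in degrees up to \<open>s\<close>.\<close>

lemma irrelevant_power_subset:
  "irrelevant_ideal V [^]\<^bsub>ideals_set (mpoly_ring V)\<^esub> k \<subseteq>
    {p :: 'k::field mpoly. p \<in> carrier (mpoly_ring V) \<and> (\<forall>t<k. hcomponent t p = 0)}"
proof (induction k)
  case 0
  show ?case
    by (simp add: ideals_set_def)
next
  let ?H = "\<lambda>k. {p :: 'k mpoly. p \<in> carrier (mpoly_ring V) \<and> (\<forall>t<k. hcomponent t p = 0)}"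
  case (Suc k)
  have m: "irrelevant_ideal V \<subseteq> ?H 1"
    unfolding irrelevant_ideal_def
    by (rule ring.genideal_minimal[OF ring_mpoly_ring ideal_high_degree])
      (auto simp: carrier_mpoly_ring_var hcomponent_of_form[OF var_form])
  have prod: "p * q \<in> ?H (Suc k)" if p: "p \<in> ?H k" and q: "q \<in> ?H 1" for p q :: "'k mpoly"
  proof -
    \<comment> \<open>Components of \<open>p\<close> below degree \<open>k\<close> vanish. For
      \<open>d \<ge> k\<close> one has \<open>t \<le> d\<close>, and the case \<open>t = d\<close>
      involves only the constant term of \<open>q\<close>, which is 0.\<close>
    have "hcomponent t (hcomponent d p * q) = 0" if t: "t < Suc k" for t d
    proof (cases "d < k")
      case True
      then show ?thesis
        using p by simp
    next
      case False
      have pd: "hcomponent d p \<in> forms V d"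
        using p by (simp add: hcomponent_forms)
      have "t < d \<or> t = d"
        using False t by linarith
      then show ?thesis
        using hcomponent_form_times(1)[OF pd, of 0 q] hcomponent_form_times(2)[OF pd, of t q] q by auto
    qed
    then have "hcomponent t (\<Sum>d\<in>mdeg ` Poly_Mapping.keys p. hcomponent d p * q) = 0" if "t < Suc k" for t
      using that by (simp add: hcomponent_sum)
    then show ?thesis
      using p q sum_hcomponents[of p] by (simp add: carrier_mpoly_ring_mult flip: sum_distrib_right)
  qed
  show ?case
  proof
    fix x :: "'k mpoly" assume "x \<in> irrelevant_ideal V [^]\<^bsub>ideals_set (mpoly_ring V)\<^esub> Suc k"
    then have "x \<in> ideal_prod (mpoly_ring V) (irrelevant_ideal V [^]\<^bsub>ideals_set (mpoly_ring V)\<^esub> k) (irrelevant_ideal V)"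
      by (simp add: ideals_set_def)
    then show "x \<in> ?H (Suc k)"
    proof induction
      case (prod i j)
      then show ?case
        using Suc.IH m \<open>\<And>p q. p \<in> ?H k \<Longrightarrow> q \<in> ?H 1 \<Longrightarrow> p * q \<in> ?H (Suc k)\<close>
        by (metis (no_types, lifting) mpoly_ring_simps(1) subsetD)
    next
      case (sum s1 s2)
      then show ?case
        by (simp add: carrier_mpoly_ring_add hcomponent_add)
    qed
  qed
qed

text \<open>Some variable of \<open>m\<close> is split off, and the remaining monomial lies in the
  previous power.\<close>

lemma single_in_irrelevant_power:
  assumes "Poly_Mapping.keys m \<subseteq> V" "k \<le> mdeg m"
  shows "Poly_Mapping.single m c \<in> irrelevant_ideal V [^]\<^bsub>ideals_set (mpoly_ring V)\<^esub> k"
  using assms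
proof (induction k arbitrary: m)
  case 0
  then show ?case
    by (simp add: ideals_set_def)
next
  case (Suc k)
  then have "mdeg m \<noteq> 0"
    by simp
  then obtain i where i: "i \<in> Poly_Mapping.keys m"
    by (auto simp: mdeg_def)
  let ?m = "m - Poly_Mapping.single i 1"
  have m: "?m + Poly_Mapping.single i 1 = m"
    using i by (intro single_le_imp_add) (simp add: in_keys_iff)
  have "Poly_Mapping.keys ?m \<subseteq> V" "k \<le> mdeg ?m"
    using Suc.prems keys_add_nat[of ?m "Poly_Mapping.single i 1"] mdeg_add[of ?m "Poly_Mapping.single i 1"]
    unfolding m by auto
  then have "Poly_Mapping.single ?m c \<in> irrelevant_ideal V [^]\<^bsub>ideals_set (mpoly_ring V)\<^esub> k"
    by (rule Suc.IH)
  moreover have "var i \<in> irrelevant_ideal V"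
  proof -
    have "var ` V \<subseteq> carrier (mpoly_ring V)"
      by (auto intro: carrier_mpoly_ring_var)
    then show ?thesis
      unfolding irrelevant_ideal_def
      using i Suc.prems(1) ring.genideal_self[OF ring_mpoly_ring, of "var ` V" V] by blast
  qed
  ultimately have "Poly_Mapping.single ?m c * var i \<in>
      ideal_prod (mpoly_ring V) (irrelevant_ideal V [^]\<^bsub>ideals_set (mpoly_ring V)\<^esub> k) (irrelevant_ideal V)"
    using ideal_prod.prod[where R = "mpoly_ring V"] by fastforce
  moreover have "Poly_Mapping.single ?m c * var i = Poly_Mapping.single m c"
    unfolding var_def mult_single m by simp
  ultimately show ?case
    by (simp add: ideals_set_def)
qed

lemma forms_subset_irrelevant_power:
  assumes "k \<le> t"
  shows "forms V t \<subseteq> irrelevant_ideal V [^]\<^bsub>ideals_set (mpoly_ring V)\<^esub> k"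
proof
  fix p :: "'a mpoly" assume p: "p \<in> forms V t"
  have "(\<Sum>m\<in>Poly_Mapping.keys p. Poly_Mapping.single m (Poly_Mapping.lookup p m)) \<in>
      irrelevant_ideal V [^]\<^bsub>ideals_set (mpoly_ring V)\<^esub> k"
    using p assms
    by (intro ideal_sum_mpoly[OF irrelevant_power_ideal] single_in_irrelevant_power)
      (auto simp: mem_forms in_keys_iff)
  then show "p \<in> irrelevant_ideal V [^]\<^bsub>ideals_set (mpoly_ring V)\<^esub> k"
    using sum_singles[of p] by simp
qed

section \<open>Artinian graded quotients\<close>

text \<open>Modulo \<open>I\<close> only degrees up to \<open>s\<close> survive. A descending chain
  is pulled back to ideals \<open>P i\<close> containing \<open>I\<close>, and each of these is
  determined by its intersection with the finite-dimensional space \<open>F\<close>.\<close>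

lemma artinian_quotient:
  fixes I :: "'k::field mpoly set"
  assumes I: "ideal I (mpoly_ring V)" and V: "finite V" and high: "\<And>t. t > s \<Longrightarrow> forms V t \<subseteq> I"
  shows "artinian_ring (quot_alg V I)"
  unfolding artinian_ring_def
proof (intro conjI allI impI)
  show "ring (quot_alg V I)"
    using I by (rule ideal.quotient_is_ring)
  interpret R: ring "mpoly_ring V :: 'k mpoly ring"
    by (rule ring_mpoly_ring)
  fix C :: "nat \<Rightarrow> 'k mpoly set set"
  assume C: "\<forall>i. ideal (C i) (quot_alg V I) \<and> C (Suc i) \<subseteq> C i"
  define F where "F = mpoly.span (monomials_upto V s :: 'k mpoly set)"
  define P where "P i = \<Union> (C i)" for i
  have Pid: "ideal (P i) (mpoly_ring V)" for i
    unfolding P_def using C by (intro R.quot_ideal_imp_ring_ideal[OF I]) simp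
  have Cin: "C i \<subseteq> carrier (quot_alg V I)" for i
    using C ideal.axioms(1) additive_subgroup.a_subset by blast
  have Pmem: "p \<in> P i \<longleftrightarrow> I +>\<^bsub>mpoly_ring V\<^esub> p \<in> C i" if "p \<in> carrier (mpoly_ring V)" for p i
    unfolding P_def by (rule R.canonical_proj_vimage_mem_iff[OF I Cin that])
  have IP: "I \<subseteq> P i" for i
  proof
    fix p assume p: "p \<in> I"
    then have "I +>\<^bsub>mpoly_ring V\<^esub> p = I +>\<^bsub>mpoly_ring V\<^esub> 0"
      using quot_proj_eq_iff[OF I, of p 0] by simp
    then show "p \<in> P i"
      using Pmem[of p i] Pmem[of 0 i] Pid[of i] I p by (auto simp: ideal_mpoly_ring_iff)
  qed
  have Psub: "mpoly.subspace (P i \<inter> F)" for i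
    unfolding F_def by (intro mpoly.subspace_inter subspace_ideal[OF Pid] mpoly.subspace_span)
  have fin: "P i \<inter> F \<subseteq> mpoly.span (monomials_upto V s)" for i
    unfolding F_def by simp
  have anti: "P j \<subseteq> P i" if "i \<le> j" for i j
    using lift_Suc_antimono_le[of C i j] C that unfolding P_def by (intro Union_mono) auto
  have dim_anti: "mpoly.dim (P j \<inter> F) \<le> mpoly.dim (P i \<inter> F)" if "i \<le> j" for i j
    using anti[OF that] by (intro mpoly.dim_mono_fin[OF Psub Psub _ fin] finite_monomials_upto V) auto
  \<comment> \<open>From an index of minimal dimension on, the dimensions are constant, and nested
    subspaces of equal finite dimension coincide.\<close>
  obtain N where N: "\<And>i. mpoly.dim (P N \<inter> F) \<le> mpoly.dim (P i \<inter> F)"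
    using ex_has_least_nat[of "\<lambda>_. True" 0 "\<lambda>i. mpoly.dim (P i \<inter> F)"] by auto
  have "C i = C N" if "i \<ge> N" for i
  proof -
    have "P i \<inter> F = P N \<inter> F"
      using anti[OF that] N[of i] dim_anti[OF that]
      by (intro mpoly.subspace_eq_if_dim_eq[OF Psub Psub _ fin] finite_monomials_upto V) auto
    \<comment> \<open>The part of \<open>p\<close> above degree \<open>s\<close> lies in
      \<open>I\<close> and hence in every \<open>P i\<close>; the rest lies in \<open>F\<close>,
      where \<open>P i\<close> and \<open>P N\<close> agree.\<close>
    moreover have "p \<in> P i" if p: "p \<in> P N" and eq: "P i \<inter> F = P N \<inter> F" for p
    proof -
      have pc: "p \<in> carrier (mpoly_ring V)"
        using p Pid[of N] by (auto simp: ideal_mpoly_ring_iff)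
      let ?q = "\<Sum>t\<in>mdeg ` Poly_Mapping.keys p \<inter> {..s}. hcomponent t p"
      let ?r = "\<Sum>t\<in>mdeg ` Poly_Mapping.keys p - {..s}. hcomponent t p"
      have "p = ?q + ?r"
        using sum_hcomponents[of p] sum.Int_Diff[of "mdeg ` Poly_Mapping.keys p" "\<lambda>t. hcomponent t p" "{..s}"]
        by simp
      moreover have r: "?r \<in> I"
        using high hcomponent_forms[OF pc] by (intro ideal_sum_mpoly[OF I]) (meson DiffD2 atMost_iff not_le subsetD)
      moreover have "?q \<in> F"
        unfolding F_def
      proof (intro mpoly.span_sum span_monomials_upto)
        fix t m assume t: "t \<in> mdeg ` Poly_Mapping.keys p \<inter> {..s}"
          and "Poly_Mapping.lookup (hcomponent t p) m \<noteq> 0"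
        then have "Poly_Mapping.keys m \<subseteq> V \<and> mdeg m = t"
          using hcomponent_forms[OF pc, of t] unfolding mem_forms by blast
        then show "Poly_Mapping.keys m \<subseteq> V \<and> mdeg m \<le> s"
          using t by simp
      qed
      moreover have "p - ?r \<in> P N"
        using p r IP by (intro ideal_diff_mpoly[OF Pid]) auto
      ultimately have "?q \<in> P i"
        using eq by (metis IntD1 IntI add_diff_cancel_right')
      then show ?thesis
        using \<open>p = ?q + ?r\<close> r IP Pid[of i] unfolding ideal_mpoly_ring_iff by (metis subsetD)
    qed
    ultimately have "P i = P N"
      using anti[OF that] by blast
    then have "x \<in> C i \<longleftrightarrow> x \<in> C N" for x
    proof (cases "x \<in> carrier (quot_alg V I)")
      case True
      then obtain p where "p \<in> carrier (mpoly_ring V)" "x = I +>\<^bsub>mpoly_ring V\<^esub> p"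
        by (auto simp: FactRing_def A_RCOSETS_def')
      then show ?thesis
        using Pmem \<open>P i = P N\<close> by blast
    next
      case False
      then show ?thesis
        using Cin by blast
    qed
    then show ?thesis
      by blast
  qed
  then show "\<exists>N. \<forall>i\<ge>N. C i = C N"
    by blast
qed

section \<open>The truncated sum of an increasing chain of ideals\<close>

text \<open>Monotonicity gives absorption: a form of degree \<open>d\<close> carries the component
  of degree \<open>t - d\<close>, which lies in \<open>D (t - d)\<close>, to one of degree
  \<open>t\<close>, and \<open>D t\<close> contains \<open>D (t - d)\<close>.\<close>

lemma homogeneous_increasing_ideal:
  fixes D :: "nat \<Rightarrow> 'k::field mpoly set"
  assumes D: "\<And>t. ideal (D t) (mpoly_ring V)" and mono: "\<And>t t'. t \<le> t' \<Longrightarrow> D t \<subseteq> D t'"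
  shows "homogeneous_ideal V {p \<in> carrier (mpoly_ring V). \<forall>t. hcomponent t p \<in> D t}"
    (is "homogeneous_ideal V ?I")
  unfolding homogeneous_ideal_def ideal_mpoly_ring_iff
proof (intro conjI ballI allI)
  have D0: "0 \<in> D t" for t
    using D[of t] by (simp add: ideal_mpoly_ring_iff)
  show "?I \<subseteq> carrier (mpoly_ring V)" "0 \<in> ?I"
    using D0 by auto
  show "p + q \<in> ?I" if "p \<in> ?I" "q \<in> ?I" for p q
    using that D by (simp add: ideal_mpoly_ring_iff carrier_mpoly_ring_add hcomponent_add)
  show "hcomponent t p \<in> ?I" if p: "p \<in> ?I" for p t
  proof -
    have "hcomponent t p \<in> forms V t"
      using p by (simp add: hcomponent_forms)
    then show ?thesis
      using p D0 forms_subset_carrier hcomponent_of_form[of "hcomponent t p" V t] by auto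
  qed
  fix r p :: "'k mpoly" assume r: "r \<in> carrier (mpoly_ring V)" and p: "p \<in> ?I"
  have "hcomponent t (hcomponent d r * p) \<in> D t" for t d
  proof (cases "d \<le> t")
    case True
    have "hcomponent d r * hcomponent (t - d) p \<in> D (t - d)"
      using p D[of "t - d"] subsetD[OF forms_subset_carrier hcomponent_forms[OF r]]
      by (auto simp: ideal_mpoly_ring_iff)
    then show ?thesis
      using hcomponent_form_times(1)[OF hcomponent_forms[OF r], of d "t - d" p] mono[of "t - d" t] True
      by auto
  next
    case False
    then show ?thesis
      using hcomponent_form_times(2)[OF hcomponent_forms[OF r], of t d p] D0 by simp
  qed
  then have "hcomponent t (\<Sum>d\<in>mdeg ` Poly_Mapping.keys r. hcomponent d r * p) \<in> D t" for t
    unfolding hcomponent_sum by (intro ideal_sum_mpoly[OF D])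
  then have "hcomponent t (r * p) \<in> D t" for t
    using sum_hcomponents[of r] by (simp flip: sum_distrib_right)
  then show "r * p \<in> ?I"
    using r p by (simp add: carrier_mpoly_ring_mult)
qed

lemma trunc_ideal_hcomponent:
  assumes "homogeneous_ideal V E" "p \<in> trunc_ideal V E v"
  shows "p \<in> carrier (mpoly_ring V)" "hcomponent t p \<in> E" "t < v \<Longrightarrow> hcomponent t p = 0"
proof -
  obtain g T where g: "p = (\<Sum>t\<in>T. g t)" "finite T" "T \<subseteq> {v..}" "\<forall>t\<in>T. g t \<in> E \<inter> forms V t"
    using assms(2) unfolding trunc_ideal_def by blast
  have E: "ideal E (mpoly_ring V)"
    using assms(1) by (simp add: homogeneous_ideal_def)
  show "p \<in> carrier (mpoly_ring V)"
    unfolding g(1) using g(4) forms_subset_carrier by (intro carrier_mpoly_ring_sum) blast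
  \<comment> \<open>The summands are forms of distinct degrees, so they are the homogeneous
    components of \<open>p\<close>.\<close>
  have comp: "hcomponent t p = (\<Sum>t'\<in>T. if t = t' then g t' else 0)" for t
    unfolding g(1) hcomponent_sum
  proof (intro sum.cong refl)
    fix x assume "x \<in> T"
    then have "g x \<in> forms V x"
      using g(4) by simp
    then show "hcomponent t (g x) = (if t = x then g x else 0)"
      by (rule hcomponent_of_form)
  qed
  have "hcomponent t p = (if t \<in> T then g t else 0)"
    unfolding comp using g(2) by simp
  then show "hcomponent t p \<in> E" "t < v \<Longrightarrow> hcomponent t p = 0"
    using g(3,4) E by (auto simp: ideal_mpoly_ring_iff)
qed

lemma form_in_trunc_ideal: "p \<in> E \<Longrightarrow> p \<in> forms V t \<Longrightarrow> v \<le> t \<Longrightarrow> p \<in> trunc_ideal V E v"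
  unfolding trunc_ideal_def by (intro CollectI exI[of _ "\<lambda>_. p"] exI[of _ "{t}"]) auto

text \<open>In degree \<open>t \<le> s\<close> only the largest of the ideals that contribute matters, namely \<open>E (b t)\<close>.\<close>

lemma truncated_sum_eq:
  fixes E :: "nat \<Rightarrow> 'k::field mpoly set"
  assumes E: "\<And>i. i \<in> {1..L} \<Longrightarrow> homogeneous_ideal V (E i)"
    and mono: "\<And>i j. i \<in> {1..L} \<Longrightarrow> j \<in> {1..L} \<Longrightarrow> i \<le> j \<Longrightarrow> E i \<subseteq> E j"
    and b: "\<And>t. b t \<in> {1..L}" "\<And>t. b t = 1 \<or> u (b t) \<le> t"
      "\<And>i t. i \<in> {2..L} \<Longrightarrow> u i \<le> t \<Longrightarrow> i \<le> b t"
  shows "E 1 + (\<Sum>i\<in>{2..L}. trunc_ideal V (E i) (u i)) +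
      irrelevant_ideal V [^]\<^bsub>ideals_set (mpoly_ring V)\<^esub> (s + 1) =
    {p \<in> carrier (mpoly_ring V). \<forall>t. hcomponent t p \<in> (if t \<le> s then E (b t) else carrier (mpoly_ring V))}"
    (is "?E + ?T + ?M = ?I")
proof (rule subset_antisym)
  have L: "1 \<in> {1..L}"
    using b(1)[of 0] by auto
  have id: "ideal (E i) (mpoly_ring V)" if "i \<in> {1..L}" for i
    using E[OF that] by (simp add: homogeneous_ideal_def)
  have T: "?T = {sum f {2..L} |f. \<forall>i\<in>{2..L}. f i \<in> trunc_ideal V (E i) (u i)}"
    by (rule set_sum_alt) simp
  show "?E + ?T + ?M \<subseteq> ?I"
  proof
    fix p assume "p \<in> ?E + ?T + ?M"
    then obtain e f m where p: "p = e + sum f {2..L} + m" and e: "e \<in> E 1" and m: "m \<in> ?M"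
      and f: "\<And>i. i \<in> {2..L} \<Longrightarrow> f i \<in> trunc_ideal V (E i) (u i)"
      unfolding T by (auto elim!: set_plus_elim)
    have m': "m \<in> carrier (mpoly_ring V)" "\<And>t. t \<le> s \<Longrightarrow> hcomponent t m = 0"
      using m irrelevant_power_subset[of V "s + 1"] by auto
    have e': "e \<in> carrier (mpoly_ring V)"
      using e id[OF L] by (auto simp: ideal_mpoly_ring_iff)
    have f': "f i \<in> carrier (mpoly_ring V)" if "i \<in> {2..L}" for i
      using trunc_ideal_hcomponent(1)[OF E f[OF that]] that by simp
    have pc: "p \<in> carrier (mpoly_ring V)"
      unfolding p using e' m' f' by (intro carrier_mpoly_ring_add carrier_mpoly_ring_sum)
    have "hcomponent t p \<in> E (b t)" if "t \<le> s" for t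
    proof -
      have "hcomponent t e \<in> E (b t)"
        using e E[OF L] mono[OF L b(1)] b(1)[of t] unfolding homogeneous_ideal_def by auto
      moreover have "hcomponent t (f i) \<in> E (b t)" if i: "i \<in> {2..L}" for i
      proof (cases "u i \<le> t")
        case True
        then have "E i \<subseteq> E (b t)"
          using i b by (intro mono) auto
        then show ?thesis
          using trunc_ideal_hcomponent(2)[OF E f[OF i], of t] i by auto
      next
        case False
        then show ?thesis
          using trunc_ideal_hcomponent(3)[OF E f[OF i], of t] i id[OF b(1)]
          by (simp add: ideal_mpoly_ring_iff)
      qed
      then have "hcomponent t (sum f {2..L}) \<in> E (b t)"
        unfolding hcomponent_sum by (intro ideal_sum_mpoly[OF id[OF b(1)]])
      ultimately show ?thesis
        using id[OF b(1), of t] m'(2)[OF that] by (simp add: p hcomponent_add ideal_mpoly_ring_iff)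
    qed
    then show "p \<in> ?I"
      using pc subsetD[OF forms_subset_carrier hcomponent_forms[OF pc]] by simp
  qed
  have zT: "0 \<in> trunc_ideal V (E i) v" for i v
    unfolding trunc_ideal_def by (intro CollectI exI[of _ "\<lambda>_. 0"] exI[of _ "{}"]) auto
  have M: "ideal ?M (mpoly_ring V)"
    by (rule irrelevant_power_ideal)
  have zero: "0 \<in> E 1" "0 \<in> ?M" "0 \<in> ?T"
    using id[OF L] M zT by (auto simp: ideal_mpoly_ring_iff T intro!: exI[of _ "\<lambda>_. 0"])
  \<comment> \<open>\<open>trunc_ideal\<close> allows any finite index set, so the representations
    of \<open>p\<close> and \<open>q\<close> need not share theirs; the sum is expanded anew into
    its own homogeneous components.\<close>
  have tadd: "p + q \<in> trunc_ideal V (E i) v"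
    if "p \<in> trunc_ideal V (E i) v" "q \<in> trunc_ideal V (E i) v" "i \<in> {1..L}" for p q i v
  proof -
    note hom = E[OF that(3)]
    let ?S = "mdeg ` Poly_Mapping.keys (p + q) \<inter> {v..}"
    have pq: "p + q \<in> carrier (mpoly_ring V)"
      using trunc_ideal_hcomponent(1)[OF hom] that by (intro carrier_mpoly_ring_add)
    have "hcomponent t (p + q) \<in> E i" for t
      using trunc_ideal_hcomponent(2)[OF hom] that id by (auto simp: hcomponent_add ideal_mpoly_ring_iff)
    moreover have "p + q = (\<Sum>t\<in>?S. hcomponent t (p + q))"
    proof -
      have "(\<Sum>t\<in>?S. hcomponent t (p + q)) = (\<Sum>t\<in>mdeg ` Poly_Mapping.keys (p + q). hcomponent t (p + q))"
        using trunc_ideal_hcomponent(3)[OF hom that(1)] trunc_ideal_hcomponent(3)[OF hom that(2)]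
        by (intro sum.mono_neutral_left) (auto simp: hcomponent_add not_le)
      then show ?thesis
        using sum_hcomponents[of "p + q"] by simp
    qed
    ultimately show ?thesis
      unfolding trunc_ideal_def using hcomponent_forms[OF pq]
      by (intro CollectI exI[of _ "\<lambda>t. hcomponent t (p + q)"] exI[of _ ?S]) auto
  qed
  have Tadd: "x + y \<in> ?T" if xy: "x \<in> ?T" "y \<in> ?T" for x y
  proof -
    obtain f g where "x = sum f {2..L}" "y = sum g {2..L}"
      "\<forall>i\<in>{2..L}. f i \<in> trunc_ideal V (E i) (u i)" "\<forall>i\<in>{2..L}. g i \<in> trunc_ideal V (E i) (u i)"
      using xy unfolding T by blast
    then show ?thesis
      unfolding T using tadd
      by (intro CollectI exI[of _ "\<lambda>i. f i + g i"]) (auto simp: sum.distrib)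
  qed
  have add: "x + y \<in> ?E + ?T + ?M" if xy: "x \<in> ?E + ?T + ?M" "y \<in> ?E + ?T + ?M" for x y
  proof -
    obtain a1 a2 a3 b1 b2 b3 where ab: "x = a1 + a2 + a3" "y = b1 + b2 + b3"
      "a1 \<in> E 1" "b1 \<in> E 1" "a2 \<in> ?T" "b2 \<in> ?T" "a3 \<in> ?M" "b3 \<in> ?M"
      using xy by (auto elim!: set_plus_elim)
    then have "(a1 + b1) + (a2 + b2) + (a3 + b3) \<in> ?E + ?T + ?M"
      using id[OF L] M Tadd by (intro set_plus_intro) (simp_all add: ideal_mpoly_ring_iff)
    moreover have "x + y = (a1 + b1) + (a2 + b2) + (a3 + b3)"
      using ab(1,2) by (simp add: add_ac)
    ultimately show ?thesis
      by simp
  qed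
  show "?I \<subseteq> ?E + ?T + ?M"
  proof
    fix p assume p: "p \<in> ?I"
    then have pc: "p \<in> carrier (mpoly_ring V)"
      by simp
    have comp: "hcomponent t p \<in> ?E + ?T + ?M" for t
    proof -
      note form = hcomponent_forms[OF pc, of t]
      have pE: "hcomponent t p \<in> E (b t)" if "t \<le> s"
      proof -
        have "\<forall>t. hcomponent t p \<in> (if t \<le> s then E (b t) else carrier (mpoly_ring V))"
          using p by simp
        from spec[OF this, of t] show ?thesis
          using that by simp
      qed
      \<comment> \<open>Each component comes from a single summand: the power of the irrelevant
        ideal, the untruncated \<open>E 1\<close>, or the truncation of
        \<open>E (b t)\<close>.\<close>
      consider "t > s" | "t \<le> s" "b t = 1" | "t \<le> s" "b t \<noteq> 1"
        by linarith
      then show ?thesis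
      proof cases
        case 1
        then have "hcomponent t p \<in> ?M"
          using form forms_subset_irrelevant_power[of "s + 1" t V] by auto
        then show ?thesis
          using set_plus_intro[OF set_plus_intro[OF zero(1,3)]] by fastforce
      next
        case 2
        then have "hcomponent t p \<in> E 1"
          using pE by simp
        then show ?thesis
          using set_plus_intro[OF set_plus_intro[OF _ zero(3)] zero(2)] by fastforce
      next
        case 3
        then have bt: "b t \<in> {2..L}" "u (b t) \<le> t" "hcomponent t p \<in> E (b t)"
          using b(1,2)[of t] pE by auto
        then have "hcomponent t p \<in> trunc_ideal V (E (b t)) (u (b t))"
          using form by (intro form_in_trunc_ideal)
        then have "hcomponent t p \<in> ?T"
          unfolding T using bt(1) zT
          by (intro CollectI exI[of _ "\<lambda>i. if i = b t then hcomponent t p else 0"])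
            (auto simp: sum.delta')
        then show ?thesis
          using set_plus_intro[OF set_plus_intro[OF zero(1)] zero(2)] by fastforce
      qed
    qed
    have sum: "(\<Sum>t\<in>S. hcomponent t p) \<in> ?E + ?T + ?M" if "finite S" for S
      using that
    proof (induction S)
      case empty
      show ?case
        using set_plus_intro[OF set_plus_intro[OF zero(1,3)] zero(2)] by simp
    next
      case (insert t S)
      then show ?case
        using add[OF comp] by simp
    qed
    have "(\<Sum>t\<in>mdeg ` Poly_Mapping.keys p. hcomponent t p) \<in> ?E + ?T + ?M"
      by (rule sum) simp
    then show "p \<in> ?E + ?T + ?M"
      by (simp only: sum_hcomponents[symmetric])
  qed
qed

section \<open>First differences and plateaus\<close>

lemma sum_fst_diff: "(\<Sum>j\<le>t. fst_diff f j) = int (f t)"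
  by (induction t) (simp_all add: fst_diff_def)

text \<open>Positive parts of differences telescope as long as \<open>h\<close> does not
  decrease.\<close>

lemma sum_pos_diff:
  assumes "\<And>j. j < t \<Longrightarrow> h j \<le> h (Suc j)"
  shows "(\<Sum>j\<le>t. pos_diff h j) = h t"
  using assms
proof (induction t)
  case (Suc t)
  have "pos_diff h (Suc t) = h (Suc t) - h t"
    by (simp add: pos_diff_def fst_diff_def)
  then show ?case
    using Suc.IH Suc.prems less_SucI by (simp add: Suc.prems[of t])
qed (simp add: pos_diff_def fst_diff_def)

text \<open>The inserted 1 is the value for all \<open>t\<close> below \<open>u 2\<close>, including
  the rising part below \<open>u 1\<close>, because \<open>J 1\<close> enters the construction
  without truncation.\<close>

definition plateau_index :: "nat \<Rightarrow> (nat \<Rightarrow> nat) \<Rightarrow> nat \<Rightarrow> nat"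
  where "plateau_index L u t = Max (insert 1 {i \<in> {2..L}. u i \<le> t})"

lemma plateau_index_props:
  assumes "1 \<le> L"
  shows "plateau_index L u t \<in> {1..L}"
    and "plateau_index L u t = 1 \<or> u (plateau_index L u t) \<le> t"
    and "i \<in> {2..L} \<Longrightarrow> u i \<le> t \<Longrightarrow> i \<le> plateau_index L u t"
    and "t \<le> t' \<Longrightarrow> plateau_index L u t \<le> plateau_index L u t'"
proof -
  let ?A = "\<lambda>t. insert 1 {i \<in> {2..L}. u i \<le> t}"
  have fin: "finite (?A t)" for t
    by simp
  have mem: "plateau_index L u t \<in> ?A t"
    unfolding plateau_index_def by (rule Max_in) auto
  then show "plateau_index L u t \<in> {1..L}" "plateau_index L u t = 1 \<or> u (plateau_index L u t) \<le> t"
    using assms by auto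
  show "i \<in> {2..L} \<Longrightarrow> u i \<le> t \<Longrightarrow> i \<le> plateau_index L u t"
    unfolding plateau_index_def by (rule Max_ge) auto
  show "t \<le> t' \<Longrightarrow> plateau_index L u t \<le> plateau_index L u t'"
    unfolding plateau_index_def by (rule Max_mono) auto
qed

text \<open>The second condition on \<open>t\<close> excludes the strictly rising part, where the
  index is 1 although \<open>t < u 1\<close>.\<close>

lemma plateaus_value:
  assumes pl: "plateaus h s L u" and t: "t \<le> s" "u (plateau_index L u t) \<le> t"
  shows "h t = h (u (plateau_index L u t))"
proof -
  let ?b = "plateau_index L u t"
  have L: "1 \<le> L"
    using pl by (simp add: plateaus_def)
  note b = plateau_index_props[OF L]
  show ?thesis
  proof (cases "?b < L")
    case True
    \<comment> \<open>By maximality of the index the next plateau has not begun at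
      \<open>t\<close>.\<close>
    have "\<not> u (?b + 1) \<le> t"
      using b(3)[of "?b + 1" u t] b(1)[of u t] True by auto
    then have "t \<in> {u ?b..<u (?b + 1)}" "?b \<in> {1..<L}"
      using b(1)[of u t] t(2) True by auto
    moreover have "\<forall>i\<in>{1..<L}. \<forall>t\<in>{u i..<u (i + 1)}. h t = h (u i)"
      using pl unfolding plateaus_def by (elim conjE)
    ultimately show ?thesis
      by blast
  next
    case False
    then have b_L: "?b = L"
      using b(1)[of u t] by simp
    have "t \<in> {u L..s}"
      using t b_L by simp
    moreover have "\<forall>t\<in>{u L..s}. h t = h (u L)"
      using pl unfolding plateaus_def by (elim conjE)
    ultimately show ?thesis
      unfolding b_L by blast
  qed
qed

text \<open>Index 1 means that the first drop, at \<open>u 2\<close>, has not been reached: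
  \<open>h\<close> rises up to \<open>u 1\<close> and is constant from there to
  \<open>t\<close>.\<close>

lemma plateaus_increasing:
  assumes pl: "plateaus h s L u" and t: "t \<le> s" "plateau_index L u t = 1" and j: "j < t"
  shows "h j \<le> h (Suc j)"
proof (cases "Suc j \<le> u 1")
  case True
  moreover have "strict_mono_on {..u 1} h"
    using pl unfolding plateaus_def by (elim conjE)
  ultimately show ?thesis
    by (intro less_imp_le strict_mono_onD[of "{..u 1}" h]) auto
next
  case False
  have L: "1 \<le> L"
    using pl by (simp add: plateaus_def)
  have "h k = h (u 1)" if "u 1 \<le> k" "k \<le> t" for k
  proof -
    have "plateau_index L u k = 1"
      using plateau_index_props(4)[OF L that(2), of u] plateau_index_props(1)[OF L, of u k] t(2) by simp
    then show ?thesis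
      using plateaus_value[OF pl, of k] that t by simp
  qed
  from this[of j] this[of "Suc j"] show ?thesis
    using False j by simp
qed

section \<open>Multiplication by powers of a variable\<close>

lemma quot_power:
  assumes I: "ideal I (mpoly_ring V)" and x: "x \<in> carrier (mpoly_ring V)"
  shows "(I +>\<^bsub>mpoly_ring V\<^esub> x) [^]\<^bsub>quot_alg V I\<^esub> (d :: nat) = I +>\<^bsub>mpoly_ring V\<^esub> (x ^ d)"
    and "x ^ d \<in> carrier (mpoly_ring V)"
proof -
  interpret h: ring_hom_ring "mpoly_ring V" "quot_alg V I" "(+>\<^bsub>mpoly_ring V\<^esub>) I"
    by (rule quot_proj_hom[OF I])
  show xc: "x ^ d \<in> carrier (mpoly_ring V)" for d
    by (induction d) (use x in \<open>auto intro: carrier_mpoly_ring_mult\<close>)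
  show "(I +>\<^bsub>mpoly_ring V\<^esub> x) [^]\<^bsub>quot_alg V I\<^esub> d = I +>\<^bsub>mpoly_ring V\<^esub> (x ^ d)"
  proof (induction d)
    case 0
    show ?case
      using h.hom_one by simp
  next
    case (Suc d)
    then show ?case
      using h.hom_mult[OF xc[of d] x] by (simp add: mult.commute)
  qed
qed

lemma image_mult_graded_part:
  assumes I: "ideal I (mpoly_ring V)" and x: "x \<in> carrier (mpoly_ring V)"
    and l: "l = I +>\<^bsub>mpoly_ring V\<^esub> x"
  shows "(\<lambda>a. (l [^]\<^bsub>quot_alg V I\<^esub> (d :: nat)) \<otimes>\<^bsub>quot_alg V I\<^esub> a) ` graded_part V I i =
    (+>\<^bsub>mpoly_ring V\<^esub>) I ` ((*) (x ^ d) ` forms V i)"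
proof -
  let ?\<pi> = "(+>\<^bsub>mpoly_ring V\<^esub>) I"
  interpret h: ring_hom_ring "mpoly_ring V" "quot_alg V I" ?\<pi>
    by (rule quot_proj_hom[OF I])
  have "?\<pi> (x ^ d) \<otimes>\<^bsub>quot_alg V I\<^esub> ?\<pi> p = ?\<pi> (x ^ d * p)" if "p \<in> forms V i" for p
    using h.hom_mult[OF quot_power(2)[OF I x], of p d] that forms_subset_carrier by fastforce
  then show ?thesis
    unfolding graded_part_def image_image l quot_power(1)[OF I x] by (intro image_cong refl)
qed

text \<open>Since \<open>x\<^sub>v\<close> is a nonzerodivisor modulo the extended ideal \<open>E\<close>, the kernel of multiplication by
  \<open>x\<^sub>v^d\<close> into a degree where \<open>I\<close> agrees with \<open>E\<close> consists of the forms in \<open>E\<close>.\<close>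

lemma rank_var_power:
  fixes I J :: "'k::field mpoly set"
  assumes J: "ideal J (mpoly_ring V)" and v: "v \<notin> V" and V: "finite V"
    and I: "ideal I (mpoly_ring (insert v V))"
    and agree: "forms (insert v V) (i + d) \<inter> I = forms (insert v V) (i + d) \<inter> ext_ideal v V J"
  shows "ring.dim (quot_alg (insert v V) I) (scalars (insert v V) I)
      ((+>\<^bsub>mpoly_ring (insert v V)\<^esub>) I ` ((*) (var v ^ d) ` forms (insert v V) i)) =
    hilbert (insert v V) (ext_ideal v V J) i"
proof -
  let ?W = "insert v V" and ?f = "(*) (var v ^ d :: 'k mpoly)" and ?E = "ext_ideal v V J"
  let ?A = "forms ?W i :: 'k mpoly set"
  interpret f: Vector_Spaces.linear "\<lambda>c p. const c * p" "\<lambda>c p. const c * p" ?f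
    by (rule linear_times)
  have E: "ideal ?E (mpoly_ring ?W)"
    by (rule ideal_ext_ideal[OF J v])
  have fA: "?f ` ?A \<subseteq> forms ?W (i + d)"
    using forms_times[OF var_power_form, of v ?W _ i d] by (auto simp: add.commute)
  have fin: "finite (monomials_upto ?W t :: 'k mpoly set)" for t
    using V by (simp add: finite_monomials_upto)
  \<comment> \<open>\<open>agree\<close> replaces \<open>I\<close> by the extended ideal in the
    target degree, and there the power of \<open>var v\<close> can be cancelled.\<close>
  have "p \<in> ?A \<Longrightarrow> ?f p \<in> I \<longleftrightarrow> p \<in> ?E" for p
    using fA agree var_power_times_ext_ideal_iff[OF _ J, of p v d] forms_subset_carrier[of ?W i] by blast
  then have ker: "?f ` ?A \<inter> I = ?f ` (?A \<inter> ?E)"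
    by blast
  have sub: "mpoly.subspace (?A \<inter> ?E)"
    by (intro mpoly.subspace_inter subspace_forms subspace_ideal[OF E])
  have "mpoly.dim (?f ` ?A) = mpoly.dim ?A" "mpoly.dim (?f ` (?A \<inter> ?E)) = mpoly.dim (?A \<inter> ?E)"
    using forms_finite_dim[of ?W i]
    by (intro mpoly.dim_inj_image[OF linear_times _ inj_var_power _ fin] subspace_forms sub; blast)+
  moreover have "ring.dim (quot_alg ?W I) (scalars ?W I) ((+>\<^bsub>mpoly_ring ?W\<^esub>) I ` (?f ` ?A)) =
      mpoly.dim (?f ` ?A) - mpoly.dim (?f ` ?A \<inter> I)"
    using fA forms_subset_carrier[of ?W "i + d"] forms_finite_dim[of ?W "i + d"]
    by (intro dim_quot_image[OF I f.subspace_image[OF subspace_forms] _ _ fin]) blast+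
  ultimately show ?thesis
    using V E by (simp add: ker hilbert_eq)
qed

theorem proposition4p5:
  fixes n s L :: nat
    and h u :: "nat \<Rightarrow> nat"
    and J :: "nat \<Rightarrow> 'k::field mpoly set"
  assumes h_pos: "\<forall>t\<le>s. h t > 0"
    and h_zero: "\<forall>t>s. h t = 0"
    and h_0: "h 0 = 1"
    and h_1: "h 1 \<le> n + 1"
    and h_unimodal: "unimodal h s"
    and h_O: "O_sequence TYPE('k) h"
    and h_bar_O: "O_sequence TYPE('k) (pos_diff h)"
    and u: "plateaus h s L u"
    and J_homogeneous: "\<forall>i\<in>{1..L}. homogeneous_ideal {1..n} (J i)"
    and J_artinian: "\<forall>i\<in>{1..L}. artinian_ring (quot_alg {1..n} (J i))"
    and J_chain: "\<forall>i\<in>{1..<L}. J i \<subseteq> J (i + 1)"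
    and J_1: "\<forall>t. hilbert {1..n} (J 1) t = pos_diff h t"
    and J_dim: "\<forall>i\<in>{2..L}. ring.dimension (quot_alg {1..n} (J i)) (h (u i))
                  (scalars {1..n} (J i)) (carrier (quot_alg {1..n} (J i)))"
    and J_hilbert: "\<forall>i\<in>{2..L}. \<forall>t. int (hilbert {1..n} (J i) t) = fst_diff (trunc_seq h (u i)) t"
  shows "strong_lefschetz {0..n} (lefschetz_ideal n s L u J)"
proof -
  define V where "V = {1..n}"
  define W where "W = insert 0 V"
  define b where "b = plateau_index L u"
  define E where "E i = ext_ideal 0 V (J i)" for i
  \<comment> \<open>Beyond degree \<open>s\<close> the power of the irrelevant ideal contains all
    forms, so no condition is left.\<close>
  define D where "D t = (if t \<le> s then E (b t) else carrier (mpoly_ring W))" for t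
  have V: "finite V" "0 \<notin> V" and W: "finite W" "{0..n} = W"
    by (auto simp: V_def W_def)
  have L: "1 \<le> L"
    using u by (simp add: plateaus_def)
  note b = plateau_index_props[where u = u, OF L, folded b_def]
  have J: "homogeneous_ideal V (J i)" "ideal (J i) (mpoly_ring V)" if "i \<in> {1..L}" for i
    using that J_homogeneous by (simp_all add: V_def homogeneous_ideal_def)
  have J_mono: "J i \<subseteq> J j" if "i \<in> {1..L}" "j \<in> {1..L}" "i \<le> j" for i j
    using that(3,1,2)
  proof (induction j rule: dec_induct)
    case (step j)
    then show ?case
      using J_chain by fastforce
  qed simp
  have E: "homogeneous_ideal W (E i)" "ideal (E i) (mpoly_ring W)" if "i \<in> {1..L}" for i
    using homogeneous_ext_ideal[OF J(1)[OF that] V(2)] ideal_ext_ideal[OF J(2)[OF that] V(2)]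
    by (simp_all add: E_def W_def)
  have E_mono: "E i \<subseteq> E j" if "i \<in> {1..L}" "j \<in> {1..L}" "i \<le> j" for i j
    using J_mono[OF that] by (auto simp: E_def ext_ideal_def)
  have E_gen: "Idl\<^bsub>mpoly_ring W\<^esub> (J i) = E i" if "i \<in> {1..L}" for i
    using genideal_ext_ideal[OF J(2)[OF that] V(2)] by (simp add: E_def W_def)

  let ?I = "lefschetz_ideal n s L u J"
  have I_eq: "?I = {p \<in> carrier (mpoly_ring W). \<forall>t. hcomponent t p \<in> D t}"
  proof -
    have "?I = E 1 + (\<Sum>i\<in>{2..L}. trunc_ideal W (E i) (u i)) +
        irrelevant_ideal W [^]\<^bsub>ideals_set (mpoly_ring W)\<^esub> (s + 1)"
    proof -
      have "(\<Sum>i\<in>{2..L}. trunc_ideal W (Idl\<^bsub>mpoly_ring W\<^esub> (J i)) (u i)) =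
          (\<Sum>i\<in>{2..L}. trunc_ideal W (E i) (u i))"
        by (intro sum.cong) (simp_all add: E_gen)
      moreover have "Idl\<^bsub>mpoly_ring W\<^esub> (J 1) = E 1"
        using L by (intro E_gen) simp
      ultimately show ?thesis
        unfolding lefschetz_ideal_def Let_def W(2) by simp
    qed
    also have "\<dots> = {p \<in> carrier (mpoly_ring W). \<forall>t. hcomponent t p \<in> D t}"
      unfolding D_def by (rule truncated_sum_eq[OF E(1) E_mono b(1-3)])
    finally show ?thesis .
  qed
  have D: "ideal (D t) (mpoly_ring W)" for t
    using E(2)[OF b(1)] by (simp add: D_def ideal_carrier)
  have D_mono: "D t \<subseteq> D t'" if "t \<le> t'" for t t'
    using that E_mono[OF b(1) b(1) b(4)[OF that]] E(2)[OF b(1), of t]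
    by (auto simp: D_def ideal_mpoly_ring_iff)
  have I_hom: "homogeneous_ideal W ?I"
    unfolding I_eq by (rule homogeneous_increasing_ideal[OF D D_mono])
  then have I: "ideal ?I (mpoly_ring W)"
    by (simp add: homogeneous_ideal_def)
  have forms_I: "forms W t \<inter> ?I = forms W t \<inter> D t" for t
  proof -
    have "0 \<in> D t'" for t'
      using D[of t'] by (simp add: ideal_mpoly_ring_iff)
    then have "(\<forall>t'. hcomponent t' p \<in> D t') \<longleftrightarrow> p \<in> D t" if "p \<in> forms W t" for p
      using that by (auto simp: hcomponent_of_form[OF that])
    then show ?thesis
      unfolding I_eq using forms_subset_carrier by blast
  qed
  have high: "forms W t \<subseteq> ?I" if "t > s" for t
    using forms_I[of t] forms_subset_carrier[of W t] that by (auto simp: D_def)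

  have hilbert_E: "hilbert W (E i) t = (\<Sum>j\<le>t. hilbert V (J i) j)" if "i \<in> {1..L}" for i t
    using hilbert_ext_ideal[OF J(2)[OF that] V(2,1)] by (simp add: E_def W_def)
  have hilbert_E_1: "hilbert W (E 1) i = h i \<and> h i \<le> h t" if t: "t \<le> s" "b t = 1" "i \<le> t" for i t
  proof -
    have inc: "h j \<le> h (Suc j)" if "j < t" for j
      using plateaus_increasing[OF u t(1) _ that] t(2) by (simp add: b_def)
    have "hilbert W (E 1) i = (\<Sum>j\<le>i. pos_diff h j)"
      using hilbert_E[of 1 i] L J_1 by (simp add: V_def)
    moreover have "(\<Sum>j\<le>i. pos_diff h j) = h i"
      using inc t(3) by (intro sum_pos_diff) auto
    moreover have "h i \<le> h t"
      using t(3)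
    proof (induction rule: inc_induct)
      case (step k)
      then show ?case
        using inc[of k] by simp
    qed simp
    ultimately show ?thesis
      by simp
  qed
  have hilbert_E_trunc: "hilbert W (E i) t = trunc_seq h (u i) t" if "i \<in> {2..L}" for i t
  proof -
    have "int (hilbert W (E i) t) = (\<Sum>j\<le>t. fst_diff (trunc_seq h (u i)) j)"
      using hilbert_E[of i t] J_hilbert that by (simp add: V_def)
    then show ?thesis
      by (simp add: sum_fst_diff)
  qed
  \<comment> \<open>The target degree \<open>t\<close> selects the ideal, while its Hilbert function
    is evaluated at the source degree \<open>i\<close>.\<close>
  have rank: "hilbert W (E (b t)) i = min (h i) (h t)" if t: "t \<le> s" and i: "i \<le> t" for i t
  proof (cases "b t = 1")
    case True
    then show ?thesis
      using hilbert_E_1[OF t True i] by simp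
  next
    case False
    then have bt: "b t \<in> {2..L}" "u (b t) \<le> t"
      using b(1,2)[of t] by auto
    have ht: "h t = h (u (b t))"
      using plateaus_value[OF u t] bt(2) by (simp add: b_def)
    show ?thesis
    \<comment> \<open>Below \<open>u (b t)\<close> the minimum is built into
      \<open>trunc_seq\<close>; from there up to \<open>t\<close> the two degrees lie on the same
      plateau.\<close>
    proof (cases "i < u (b t)")
      case True
      then show ?thesis
        using hilbert_E_trunc[OF bt(1)] ht by (simp add: trunc_seq_def)
    next
      case False
      then have "b i = b t"
        using b(3)[OF bt(1), of i] b(4)[OF i] by simp
      then have "h i = h (u (b t))"
        using plateaus_value[OF u, of i] False t i by (simp add: b_def)
      then show ?thesis
        using hilbert_E_trunc[OF bt(1)] ht False by (simp add: trunc_seq_def)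
    qed
  qed
  \<comment> \<open>In degrees up to \<open>s\<close> this is \<open>rank\<close> with equal source
    and target degree.\<close>
  have hilbert_I: "hilbert W ?I t = h t" for t
  proof (cases "t \<le> s")
    case True
    then have "hilbert W ?I t = hilbert W (E (b t)) t"
      using I E(2)[OF b(1)] W(1) by (simp add: hilbert_eq forms_I D_def)
    then show ?thesis
      using rank[OF True order_refl] by simp
  next
    case False
    then show ?thesis
      using I W(1) high[of t] h_zero by (simp add: hilbert_eq Int_absorb2)
  qed
  have proper: "?I \<noteq> carrier (mpoly_ring W)"
  proof
    assume "?I = carrier (mpoly_ring W)"
    then have "forms W 0 \<subseteq> ?I"
      using forms_subset_carrier by simp
    then have "hilbert W ?I 0 = 0"
      using I W(1) by (simp add: hilbert_eq Int_absorb2)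
    then show False
      using hilbert_I[of 0] h_0 by simp
  qed
  have x0: "var 0 \<in> forms W 1" "var 0 \<in> carrier (mpoly_ring W)"
    by (rule var_form, simp add: W_def) (simp add: W_def carrier_mpoly_ring_var)
  have rank_x0: "ring.dim (quot_alg W ?I) (scalars W ?I)
      ((+>\<^bsub>mpoly_ring W\<^esub>) ?I ` ((*) (var 0 ^ d) ` forms W i)) = min (hilbert W ?I i) (hilbert W ?I (i + d))"
    for i d
  proof (cases "i + d \<le> s")
    case True
    then have "forms W (i + d) \<inter> ?I = forms W (i + d) \<inter> E (b (i + d))"
      using forms_I by (simp add: D_def)
    then show ?thesis
      using rank_var_power[OF J(2)[OF b(1)] V(2,1), of ?I i d "i + d", folded W_def E_def] I
        rank[OF True, of i] by (simp add: hilbert_I)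
  next
    case False
    \<comment> \<open>All forms of the target degree lie in the ideal, which therefore agrees there
      with the extension of the unit ideal; the rank computation then yields 0.\<close>
    then have "forms W (i + d) \<inter> ?I = forms W (i + d) \<inter> ext_ideal 0 V (carrier (mpoly_ring V))"
      using high[of "i + d"] forms_subset_carrier[of W "i + d"]
      by (auto simp: ext_ideal_carrier W_def)
    moreover have "hilbert W (ext_ideal 0 V (carrier (mpoly_ring V) :: 'k mpoly set)) i = 0"
      using V(1) by (simp add: ext_ideal_carrier hilbert_eq ideal_carrier W_def
          Int_absorb2[OF forms_subset_carrier])
    ultimately show ?thesis
      using rank_var_power[OF ideal_carrier V(2,1), of ?I i d, folded W_def] I False
      by (simp add: hilbert_I h_zero)
  qed
  have artinian: "artinian_ring (quot_alg W ?I)"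
    by (rule artinian_quotient[OF I W(1) high])
  define l where "l = ?I +>\<^bsub>mpoly_ring W\<^esub> var 0"
  have l: "l \<in> graded_part W ?I 1"
    unfolding l_def graded_part_def using x0(1) by (rule imageI)
  have "strong_lefschetz W ?I"
    unfolding strong_lefschetz_def standard_graded_def
  proof (intro conjI bexI[OF _ l] allI impI)
    fix i d
    show "ring.dim (quot_alg W ?I) (scalars W ?I)
        ((\<lambda>a. (l [^]\<^bsub>quot_alg W ?I\<^esub> d) \<otimes>\<^bsub>quot_alg W ?I\<^esub> a) ` graded_part W ?I i) =
      min (hilbert W ?I i) (hilbert W ?I (i + d))"
      unfolding image_mult_graded_part[OF I x0(2) l_def] by (rule rank_x0)
  qed (fact W(1) I_hom proper artinian)+
  then show ?thesis
    by (simp add: W(2))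
qed

end
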